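(* (In ZF.) Let $n>1$ and $m$ be natural numbers with $m\geq 2n$. Then for any infinite set $A$, $|S_n(A)|\le|S_m(A)|$; that is, there is an injection from $S_n(A)$ into $S_m(A)$.
   Context: Work in ZF (no Axiom of Choice). For a set $A$ and a natural number $k$, $S_k(A)$ denotes the set of permutations $\phi$ of $A$ with exactly $k$ non-fixed points, i.e. $|\{x\in A:\phi(x)\neq x\}|=k$. *)

theory Defs
  imports Main
begin

text \<open>
  HOL has a choice operator, so a choice-free theorem cannot be stated faithfully about
  HOL sets. ``In ZF'' is therefore rendered as ``in every model of first-order ZF'': a model is
  a type with a binary relation, the two schemata range over first-order formulas with
  parameters only (over all HOL predicates they would make the axiom of choice hold in
  every model), and every set-theoretic notion below is the usual first-order one, with all
  quantifiers ranging over the elements of the model.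
\<close>

text \<open>First-order formulas in the language of set theory, with de Bruijn indices.\<close>

datatype fm = FMem nat nat | FEq nat nat | FNeg fm | FConj fm fm | FAll fm

primrec sat :: "('a \<Rightarrow> 'a \<Rightarrow> bool) \<Rightarrow> fm \<Rightarrow> (nat \<Rightarrow> 'a) \<Rightarrow> bool" where
  "sat E (FMem i j) v \<longleftrightarrow> E (v i) (v j)"
| "sat E (FEq i j) v \<longleftrightarrow> v i = v j"
| "sat E (FNeg p) v \<longleftrightarrow> \<not> sat E p v"
| "sat E (FConj p q) v \<longleftrightarrow> sat E p v \<and> sat E q v"
| "sat E (FAll p) v \<longleftrightarrow> (\<forall>x. sat E p (case_nat x v))"

locale set_structure =
  fixes mem :: "'a \<Rightarrow> 'a \<Rightarrow> bool"  (infix "\<epsilon>" 50)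
begin

definition is_empty :: "'a \<Rightarrow> bool" where
  "is_empty x \<longleftrightarrow> (\<forall>z. \<not> z \<epsilon> x)"

definition is_succ :: "'a \<Rightarrow> 'a \<Rightarrow> bool" where
  "is_succ x s \<longleftrightarrow> (\<forall>z. z \<epsilon> s \<longleftrightarrow> z \<epsilon> x \<or> z = x)"

definition is_inductive :: "'a \<Rightarrow> bool" where
  "is_inductive I \<longleftrightarrow>
     (\<exists>e. is_empty e \<and> e \<epsilon> I) \<and> (\<forall>y. y \<epsilon> I \<longrightarrow> (\<exists>s. is_succ y s \<and> s \<epsilon> I))"

text \<open>
  In the two schemata the environment \<open>v\<close> supplies the parameters. Index 0 is the
  element being separated, respectively the argument of the class function, whose value
  has index 1.
\<close>

definition ZF_model :: bool where
  "ZF_model \<longleftrightarrow>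
     \<comment> \<open>Extensionality\<close>
     (\<forall>x y. (\<forall>z. z \<epsilon> x \<longleftrightarrow> z \<epsilon> y) \<longrightarrow> x = y) \<and>
     \<comment> \<open>Foundation\<close>
     (\<forall>x. (\<exists>y. y \<epsilon> x) \<longrightarrow> (\<exists>y. y \<epsilon> x \<and> \<not> (\<exists>z. z \<epsilon> x \<and> z \<epsilon> y))) \<and>
     \<comment> \<open>Pairing\<close>
     (\<forall>x y. \<exists>u. \<forall>z. z \<epsilon> u \<longleftrightarrow> z = x \<or> z = y) \<and>
     \<comment> \<open>Union\<close>
     (\<forall>x. \<exists>u. \<forall>z. z \<epsilon> u \<longleftrightarrow> (\<exists>y. y \<epsilon> x \<and> z \<epsilon> y)) \<and>
     \<comment> \<open>Power set\<close>
     (\<forall>x. \<exists>u. \<forall>z. z \<epsilon> u \<longleftrightarrow> (\<forall>w. w \<epsilon> z \<longrightarrow> w \<epsilon> x)) \<and>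
     \<comment> \<open>Infinity\<close>
     (\<exists>I. is_inductive I) \<and>
     \<comment> \<open>Separation schema\<close>
     (\<forall>p v x. \<exists>u. \<forall>z. z \<epsilon> u \<longleftrightarrow> z \<epsilon> x \<and> sat mem p (case_nat z v)) \<and>
     \<comment> \<open>Replacement schema\<close>
     (\<forall>p v x.
        (\<forall>y z z'. y \<epsilon> x \<and> sat mem p (case_nat y (case_nat z v))
                         \<and> sat mem p (case_nat y (case_nat z' v)) \<longrightarrow> z = z') \<longrightarrow>
        (\<exists>u. \<forall>z. z \<epsilon> u \<longleftrightarrow> (\<exists>y. y \<epsilon> x \<and> sat mem p (case_nat y (case_nat z v)))))"

text \<open>
  Natural numbers are those of the model (the elements of its \<open>\<omega>\<close>), as von Neumann
  ordinals; for them, \<open><\<close> is membership.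
\<close>

definition is_nat :: "'a \<Rightarrow> bool" where
  "is_nat n \<longleftrightarrow> (\<forall>I. is_inductive I \<longrightarrow> n \<epsilon> I)"

definition is_one :: "'a \<Rightarrow> bool" where
  "is_one x \<longleftrightarrow> (\<exists>e. is_empty e \<and> is_succ e x)"

definition is_upair :: "'a \<Rightarrow> 'a \<Rightarrow> 'a \<Rightarrow> bool" where
  "is_upair a b u \<longleftrightarrow> (\<forall>z. z \<epsilon> u \<longleftrightarrow> z = a \<or> z = b)"

text \<open>Kuratowski pairs.\<close>

definition is_pair :: "'a \<Rightarrow> 'a \<Rightarrow> 'a \<Rightarrow> bool" where
  "is_pair a b p \<longleftrightarrow> (\<exists>s d. is_upair a a s \<and> is_upair a b d \<and> is_upair s d p)"

text \<open>\<open>maps f a b\<close> says \<open>(a, b) \<in> f\<close>, i.e. \<open>f(a) = b\<close> when \<open>f\<close> is a function.\<close>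

definition maps :: "'a \<Rightarrow> 'a \<Rightarrow> 'a \<Rightarrow> bool" where
  "maps f a b \<longleftrightarrow> (\<exists>p. is_pair a b p \<and> p \<epsilon> f)"

definition is_function :: "'a \<Rightarrow> 'a \<Rightarrow> 'a \<Rightarrow> bool" where
  "is_function f A B \<longleftrightarrow>
     (\<forall>p. p \<epsilon> f \<longrightarrow> (\<exists>a b. a \<epsilon> A \<and> b \<epsilon> B \<and> is_pair a b p)) \<and>
     (\<forall>a. a \<epsilon> A \<longrightarrow> (\<exists>!b. maps f a b))"

definition is_injection :: "'a \<Rightarrow> 'a \<Rightarrow> 'a \<Rightarrow> bool" where
  "is_injection f A B \<longleftrightarrow>
     is_function f A B \<and> (\<forall>a a' b. maps f a b \<and> maps f a' b \<longrightarrow> a = a')"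

definition is_bijection :: "'a \<Rightarrow> 'a \<Rightarrow> 'a \<Rightarrow> bool" where
  "is_bijection f A B \<longleftrightarrow>
     is_injection f A B \<and> (\<forall>b. b \<epsilon> B \<longrightarrow> (\<exists>a. a \<epsilon> A \<and> maps f a b))"

definition equinumerous :: "'a \<Rightarrow> 'a \<Rightarrow> bool" where
  "equinumerous A B \<longleftrightarrow> (\<exists>f. is_bijection f A B)"

definition is_infinite :: "'a \<Rightarrow> bool" where
  "is_infinite A \<longleftrightarrow> \<not> (\<exists>k. is_nat k \<and> equinumerous A k)"

text \<open>
  \<open>c = a + b\<close> for natural numbers, by recursion on \<open>b\<close>: \<open>g\<close> is the
  function on \<open>{0, \<dots>, b}\<close> with \<open>g(0) = a\<close>, \<open>g(i + 1) = g(i) + 1\<close>, and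
  \<open>c = g(b)\<close>.
\<close>

definition is_sum :: "'a \<Rightarrow> 'a \<Rightarrow> 'a \<Rightarrow> bool" where
  "is_sum a b c \<longleftrightarrow>
     (\<exists>g D R. is_succ b D \<and> is_function g D R \<and>
        (\<exists>e. is_empty e \<and> maps g e a) \<and>
        (\<forall>i j u w. i \<epsilon> b \<and> is_succ i j \<and> maps g i u \<and> maps g j w \<longrightarrow> is_succ u w) \<and>
        maps g b c)"

text \<open>\<open>D = {x \<in> A. \<phi>(x) \<noteq> x}\<close>.\<close>

definition is_moved_set :: "'a \<Rightarrow> 'a \<Rightarrow> 'a \<Rightarrow> bool" where
  "is_moved_set \<phi> A D \<longleftrightarrow> (\<forall>x. x \<epsilon> D \<longleftrightarrow> x \<epsilon> A \<and> (\<exists>y. maps \<phi> x y \<and> y \<noteq> x))"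

text \<open>\<open>X = S\<^sub>k(A)\<close>.\<close>

definition is_S :: "'a \<Rightarrow> 'a \<Rightarrow> 'a \<Rightarrow> bool" where
  "is_S k A X \<longleftrightarrow>
     (\<forall>\<phi>. \<phi> \<epsilon> X \<longleftrightarrow>
        is_bijection \<phi> A A \<and> (\<exists>D. is_moved_set \<phi> A D \<and> equinumerous D k))"

end

end

theory Submission
  imports Defs
begin

text \<open>
  An infinite set \<open>A\<close> contains a grid of \<open>n + 1\<close> disjoint rows of \<open>m - n \<ge> n\<close> elements each.
  A permutation \<open>\<phi>\<close> in \<open>S\<^sub>n(A)\<close> moves too few points to meet every row; it is sent to \<open>\<phi>\<close>
  together with the cyclic permutation of one row that consists of fixed points. From the moved
  set of the result the row can be recovered, unless \<open>\<phi>\<close> moves precisely another row; in that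
  case the row is chosen such that no ambiguity arises.

  Since the model may be ill-founded from outside, its natural numbers can be nonstandard, and
  every induction and every set formation has to be justified by a first-order formula. The
  predicate \<open>dfn\<close> (and \<open>tm\<close>, for class functions) says that a condition on an environment is
  given by a formula with parameters. Its closure rules decompose conditions written with
  ordinary HOL binders, so that definability is proved by mere introduction steps.
\<close>

section \<open>Definable conditions and class functions\<close>

text \<open>Combining two formulas requires moving their variables apart, and the axiom schemata
  prescribe which index plays which role; both are achieved by renaming.\<close>

primrec ren :: "fm \<Rightarrow> (nat \<Rightarrow> nat) \<Rightarrow> fm" where
  "ren (FMem i j) f = FMem (f i) (f j)"
| "ren (FEq i j) f = FEq (f i) (f j)"
| "ren (FNeg p) f = FNeg (ren p f)"
| "ren (FConj p q) f = FConj (ren p f) (ren q f)"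
| "ren (FAll p) f = FAll (ren p (case_nat 0 (\<lambda>i. Suc (f i))))"

lemma sat_ren: "sat E (ren p f) v \<longleftrightarrow> sat E p (\<lambda>i. v (f i))"
proof (induction p arbitrary: f v)
  case (FAll p)
  have "(\<lambda>i. case_nat x v (case_nat 0 (\<lambda>i. Suc (f i)) i)) = case_nat x (\<lambda>i. v (f i))" for x
    by (auto split: nat.split)
  then show ?case by (simp add: FAll.IH)
qed simp_all

locale zf = set_structure mem for mem :: "'a \<Rightarrow> 'a \<Rightarrow> bool" (infix "\<epsilon>" 50) +
  assumes ZF: ZF_model
begin

text \<open>The map \<open>f\<close> says whether a variable of the formula \<open>p\<close> denotes a parameter, given by \<open>w\<close>,
  or an entry of the environment \<open>v\<close>; thus parameters never have to be renumbered under a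
  quantifier.\<close>

definition dfn :: "((nat \<Rightarrow> 'a) \<Rightarrow> bool) \<Rightarrow> bool" where
  "dfn P \<longleftrightarrow> (\<exists>p f w. \<forall>v. P v \<longleftrightarrow> sat mem p (\<lambda>i. case f i of None \<Rightarrow> w i | Some j \<Rightarrow> v j))"

text \<open>The language has no function symbols, so a class function counts as definable through
  its graph; the value takes index 0 and the arguments move up by one.\<close>

definition tm :: "((nat \<Rightarrow> 'a) \<Rightarrow> 'a) \<Rightarrow> bool" where
  "tm t \<longleftrightarrow> dfn (\<lambda>v. v 0 = t (\<lambda>i. v (Suc i)))"

lemma dfnI: "(\<And>v. P v \<longleftrightarrow> sat mem p (\<lambda>i. case f i of None \<Rightarrow> w i | Some j \<Rightarrow> v j)) \<Longrightarrow> dfn P"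
  unfolding dfn_def by blast

lemma dfn_mem_var: "dfn (\<lambda>v. v i \<epsilon> v j)"
  by (rule dfnI[where p = "FMem i j" and f = Some]) simp

lemma dfn_eq_var: "dfn (\<lambda>v. v i = v j)"
  by (rule dfnI[where p = "FEq i j" and f = Some]) simp

lemma dfn_eq_const: "dfn (\<lambda>v. v i = c)"
  by (rule dfnI[where p = "FEq 0 1" and f = "\<lambda>k. if k = 0 then Some i else None" and w = "\<lambda>_. c"])
     simp

lemma dfn_not: "dfn P \<Longrightarrow> dfn (\<lambda>v. \<not> P v)"
  unfolding dfn_def by (elim exE, rule_tac x = "FNeg p" in exI) auto

lemma dfn_conj:
  assumes "dfn P" "dfn Q"
  shows "dfn (\<lambda>v. P v \<and> Q v)"
proof -
  obtain p f w where p: "\<forall>v. P v \<longleftrightarrow> sat mem p (\<lambda>i. case f i of None \<Rightarrow> w i | Some j \<Rightarrow> v j)"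
    using assms(1) unfolding dfn_def by (elim exE) (rule that)
  obtain q g u where q: "\<forall>v. Q v \<longleftrightarrow> sat mem q (\<lambda>i. case g i of None \<Rightarrow> u i | Some j \<Rightarrow> v j)"
    using assms(2) unfolding dfn_def by (elim exE) (rule that)
  show ?thesis
    \<comment> \<open>The two parameter lists are interleaved: \<open>p\<close> reads the even
      indices and \<open>q\<close> the odd ones, so neither disturbs the other.\<close>
    by (rule dfnI[where p = "FConj (ren p (\<lambda>i. 2 * i)) (ren q (\<lambda>i. Suc (2 * i)))"
          and f = "\<lambda>i. if even i then f (i div 2) else g (i div 2)"
          and w = "\<lambda>i. if even i then w (i div 2) else u (i div 2)"])
       (simp add: p q sat_ren cong: option.case_cong)
qed

text \<open>The quantified value is entry 0 of the environment. Variables that denote it become the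
  bound variable; the other environment entries drop by one, and parameters keep their
  values.\<close>

lemma dfn_all:
  assumes "dfn (\<lambda>v. P (\<lambda>i. v (Suc i)) (v 0))"
  shows "dfn (\<lambda>v. \<forall>x. P v x)"
proof -
  obtain p f w where p: "\<forall>v. P (\<lambda>i. v (Suc i)) (v 0) \<longleftrightarrow>
      sat mem p (\<lambda>i. case f i of None \<Rightarrow> w i | Some j \<Rightarrow> v j)"
    using assms unfolding dfn_def by (elim exE) (rule that)
  have 1: "P v x \<longleftrightarrow> sat mem p (\<lambda>i. case f i of None \<Rightarrow> w i | Some j \<Rightarrow> case_nat x v j)" for v x
    using p[rule_format, of "case_nat x v"] by simp
  have 2: "(\<lambda>i. case f i of None \<Rightarrow> w i | Some j \<Rightarrow> case_nat x v j) =
      (\<lambda>i. case_nat x (\<lambda>i. case (case f i of Some (Suc j) \<Rightarrow> Some j | _ \<Rightarrow> None) of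
         None \<Rightarrow> w i | Some j \<Rightarrow> v j) (if f i = Some 0 then 0 else Suc i))" for v x
    by (auto split: option.split nat.split)
  show ?thesis
    unfolding 1 2
    by (intro dfnI[where p = "FAll (ren p (\<lambda>i. if f i = Some 0 then 0 else Suc i))"
          and f = "\<lambda>i. case f i of Some (Suc j) \<Rightarrow> Some j | _ \<Rightarrow> None" and w = w])
       (simp add: sat_ren)
qed

lemma dfn_const: "dfn (\<lambda>v. b)"
proof (cases b)
  case True
  then show ?thesis using dfn_eq_var[of 0 0] by simp
next
  case False
  then show ?thesis using dfn_not[OF dfn_eq_var[of 0 0]] by simp
qed

lemma dfn_ren:
  assumes "dfn P"
  shows "dfn (\<lambda>v. P (\<lambda>i. v (g i)))"
proof -
  obtain p f w where p: "\<forall>v. P v \<longleftrightarrow> sat mem p (\<lambda>i. case f i of None \<Rightarrow> w i | Some j \<Rightarrow> v j)"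
    using assms unfolding dfn_def by (elim exE) (rule that)
  have "(case f i of None \<Rightarrow> w i | Some j \<Rightarrow> v (g j)) =
      (case map_option g (f i) of None \<Rightarrow> w i | Some j \<Rightarrow> v j)" for i v
    by (cases "f i") auto
  then show ?thesis
    by (intro dfnI[where p = p and f = "\<lambda>i. map_option g (f i)" and w = w]) (simp add: p)
qed

lemma dfn_disj:
  assumes "dfn P" "dfn Q"
  shows "dfn (\<lambda>v. P v \<or> Q v)"
proof -
  have "dfn (\<lambda>v. \<not> (\<not> P v \<and> \<not> Q v))" by (intro dfn_not dfn_conj assms)
  then show ?thesis by simp
qed

lemma dfn_imp: "dfn P \<Longrightarrow> dfn Q \<Longrightarrow> dfn (\<lambda>v. P v \<longrightarrow> Q v)"
  unfolding imp_conv_disj by (intro dfn_disj dfn_not)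

lemma dfn_iff: "dfn P \<Longrightarrow> dfn Q \<Longrightarrow> dfn (\<lambda>v. P v \<longleftrightarrow> Q v)"
  unfolding iff_conv_conj_imp by (intro dfn_conj dfn_imp)

lemma dfn_ex:
  assumes "dfn (\<lambda>v. P (\<lambda>i. v (Suc i)) (v 0))"
  shows "dfn (\<lambda>v. \<exists>x. P v x)"
proof -
  have "dfn (\<lambda>v. \<not> (\<forall>x. \<not> P v x))" by (intro dfn_not dfn_all assms)
  then show ?thesis by simp
qed

text \<open>One-point rule: a term is replaced by a quantified variable that equals it, which only
  needs the graph of the term.\<close>

lemma dfn_subst:
  assumes "tm t" "dfn (\<lambda>v. P (\<lambda>i. v (Suc i)) (v 0))"
  shows "dfn (\<lambda>v. P v (t v))"
proof -
  have "dfn (\<lambda>v. \<exists>x. x = t v \<and> P v x)"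
    using assms unfolding tm_def by (intro dfn_ex dfn_conj)
  then show ?thesis by simp
qed

lemma tm_var: "tm (\<lambda>v. v i)"
  unfolding tm_def by (rule dfn_eq_var)

lemma tm_const: "tm (\<lambda>v. c)"
  unfolding tm_def by (rule dfn_eq_const)

lemma tm_ren: "tm t \<Longrightarrow> tm (\<lambda>v. t (\<lambda>i. v (g i)))"
  unfolding tm_def by (drule dfn_ren[where g = "case_nat 0 (\<lambda>i. Suc (g i))"]) simp

lemma dfn_subst1:
  assumes "dfn (\<lambda>v. R (v 0))" "tm a"
  shows "dfn (\<lambda>v. R (a v))"
  using dfn_subst[OF assms(2), of "\<lambda>v x. R x"] assms(1) by simp

lemma dfn_subst2:
  assumes "dfn (\<lambda>v. R (v 0) (v (Suc 0)))" "tm a" "tm b"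
  shows "dfn (\<lambda>v. R (a v) (b v))"
proof -
  have "dfn (\<lambda>v. R (v 0) (b (\<lambda>i. v (Suc i))))"
    using dfn_subst[OF tm_ren[OF assms(3), of Suc], where P = "\<lambda>v y. R (v 0) y"]
      dfn_ren[OF assms(1), of "case_nat (Suc 0) (\<lambda>_. 0)"] by simp
  from dfn_subst[OF assms(2), where P = "\<lambda>v x. R x (b v)", OF this] show ?thesis .
qed

text \<open>Substitution acts on index 0 only. The arguments are therefore brought there one after
  the other, first \<open>c\<close>, then \<open>b\<close>, then \<open>a\<close>, with
  \<open>dfn_ren\<close> permuting the variables.\<close>

lemma dfn_subst3:
  assumes "dfn (\<lambda>v. R (v 0) (v (Suc 0)) (v (Suc (Suc 0))))" "tm a" "tm b" "tm c"
  shows "dfn (\<lambda>v. R (a v) (b v) (c v))"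
proof -
  have "dfn (\<lambda>v. R (v (Suc 0)) (v (Suc (Suc 0))) (v 0))"
    using dfn_ren[OF assms(1), of "case_nat (Suc 0) (case_nat (Suc (Suc 0)) (\<lambda>_. 0))"] by simp
  from dfn_subst[OF tm_ren[OF assms(4), of "\<lambda>i. Suc (Suc i)"],
      where P = "\<lambda>v y. R (v 0) (v (Suc 0)) y", simplified, OF this]
  have "dfn (\<lambda>v. R (v (Suc 0)) (v 0) (c (\<lambda>i. v (Suc (Suc i)))))"
    by (drule_tac dfn_ren[where g = "case_nat (Suc 0) (case_nat 0 (\<lambda>i. Suc (Suc i)))"]) simp
  from dfn_subst[OF tm_ren[OF assms(3), of Suc], where P = "\<lambda>v y. R (v 0) y (c (\<lambda>i. v (Suc i)))",
      simplified, OF this]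
  have "dfn (\<lambda>v. R (v 0) (b (\<lambda>i. v (Suc i))) (c (\<lambda>i. v (Suc i))))" .
  from dfn_subst[OF assms(2), where P = "\<lambda>v x. R x (b v) (c v)", OF this] show ?thesis .
qed

lemmas dfn_mem = dfn_subst2[where R = mem, OF dfn_mem_var]
lemmas dfn_eq = dfn_subst2[where R = "(=)", OF dfn_eq_var]

lemma tm_subst1:
  assumes "dfn (\<lambda>v. v 0 = F (v (Suc 0)))" "tm a"
  shows "tm (\<lambda>v. F (a v))"
  unfolding tm_def
  using dfn_subst2[where R = "\<lambda>y x. y = F x", OF assms(1) tm_var tm_ren[OF assms(2)]] .

lemma tm_subst2:
  assumes "dfn (\<lambda>v. v 0 = F (v (Suc 0)) (v (Suc (Suc 0))))" "tm a" "tm b"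
  shows "tm (\<lambda>v. F (a v) (b v))"
  unfolding tm_def
  using dfn_subst3[where R = "\<lambda>y x x'. y = F x x'",
      OF assms(1) tm_var tm_ren[OF assms(2)] tm_ren[OF assms(3)]] .

lemma dfn_ex1:
  assumes "dfn (\<lambda>v. P (\<lambda>i. v (Suc i)) (v 0))"
  shows "dfn (\<lambda>v. \<exists>!x. P v x)"
proof -
  have "dfn (\<lambda>v. P (\<lambda>i. v (Suc (Suc i))) (v 0))"
    using dfn_ren[OF assms, of "case_nat 0 (\<lambda>i. Suc (Suc i))"] by simp
  then show ?thesis unfolding Ex1_def
    by (intro dfn_ex dfn_conj assms dfn_all dfn_imp dfn_eq tm_var)
qed

lemma tm_if:
  assumes "dfn P" "tm a" "tm b"
  shows "tm (\<lambda>v. if P v then a v else b v)"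
proof -
  have "dfn (\<lambda>v. (P (\<lambda>i. v (Suc i)) \<longrightarrow> v 0 = a (\<lambda>i. v (Suc i))) \<and>
                  (\<not> P (\<lambda>i. v (Suc i)) \<longrightarrow> v 0 = b (\<lambda>i. v (Suc i))))"
    by (intro dfn_conj dfn_imp dfn_not dfn_ren[OF assms(1)] assms(2,3)[unfolded tm_def])
  then show ?thesis unfolding tm_def by (simp add: if_split)
qed

text \<open>Unlike \<open>THE\<close>, whose value is unspecified and may depend on the predicate when uniqueness
  fails, this is definable.\<close>

definition the1 :: "('a \<Rightarrow> bool) \<Rightarrow> 'a" where
  "the1 P = (if \<exists>!x. P x then THE x. P x else undefined)"

lemma the1_eq: "P x \<Longrightarrow> (\<And>y. P y \<Longrightarrow> y = x) \<Longrightarrow> the1 P = x"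
  unfolding the1_def by (metis the_equality)

lemma the1I: "\<exists>!x. P x \<Longrightarrow> P (the1 P)"
  unfolding the1_def by (simp add: theI')

lemma tm_the1:
  assumes "dfn (\<lambda>v. P (\<lambda>i. v (Suc i)) (v 0))"
  shows "tm (\<lambda>v. the1 (P v))"
proof -
  \<comment> \<open>This expresses the graph of \<open>the1\<close> by \<open>Q\<close> alone; the
    default value enters as a parameter.\<close>
  have eq: "x = the1 Q \<longleftrightarrow> ((\<exists>!x. Q x) \<longrightarrow> Q x) \<and> (\<not> (\<exists>!x. Q x) \<longrightarrow> x = undefined)" for x Q
  proof (cases "\<exists>!x. Q x")
    case True
    then show ?thesis using the1I[OF True] by auto
  qed (simp add: the1_def)
  have "dfn (\<lambda>v. P (\<lambda>i. v (Suc (Suc i))) (v 0))"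
    using dfn_ren[OF assms, of "case_nat 0 (\<lambda>i. Suc (Suc i))"] by simp
  then have "dfn (\<lambda>v. ((\<exists>!x. P (\<lambda>i. v (Suc i)) x) \<longrightarrow> P (\<lambda>i. v (Suc i)) (v 0)) \<and>
       (\<not> (\<exists>!x. P (\<lambda>i. v (Suc i)) x) \<longrightarrow> v 0 = undefined))"
    by (intro dfn_conj dfn_imp dfn_not dfn_ex1 assms dfn_eq tm_var tm_const)
  then show ?thesis unfolding tm_def eq .
qed

lemmas dfn_intros = dfn_const tm_const tm_var dfn_mem dfn_eq dfn_not dfn_conj dfn_disj dfn_imp
  dfn_iff dfn_all dfn_ex dfn_ex1 tm_if tm_the1

section \<open>Extensionality and the two schemata for definable conditions\<close>

lemma ext: "(\<And>z. z \<epsilon> x \<longleftrightarrow> z \<epsilon> y) \<Longrightarrow> x = y"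
  using ZF unfolding ZF_model_def by simp

lemma separation:
  assumes "dfn (\<lambda>v. P (v 0))"
  shows "\<exists>u. \<forall>z. z \<epsilon> u \<longleftrightarrow> z \<epsilon> x \<and> P z"
proof -
  obtain p f w where p: "\<forall>v::nat \<Rightarrow> 'a. P (v 0) \<longleftrightarrow>
      sat mem p (\<lambda>i. case f i of None \<Rightarrow> w i | Some j \<Rightarrow> v j)"
    using assms unfolding dfn_def by (elim exE) (rule that)
  \<comment> \<open>Only entry 0 of the environment matters to \<open>P\<close>, so a constant
    environment may be used. The formula then mentions only \<open>z\<close> and parameters, as the
    axiom demands.\<close>
  have 1: "P z \<longleftrightarrow> sat mem p (\<lambda>i. case f i of None \<Rightarrow> w i | Some j \<Rightarrow> z)" for z
    using p[rule_format, of "\<lambda>_. z"] by simp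
  have 2: "(\<lambda>i. case f i of None \<Rightarrow> w i | Some j \<Rightarrow> z) =
     (\<lambda>i. case_nat z w (if f i = None then Suc i else 0))" for z
    by (auto split: option.split)
  have P: "P z \<longleftrightarrow> sat mem (ren p (\<lambda>i. if f i = None then Suc i else 0)) (case_nat z w)" for z
    unfolding 1 2 by (simp add: sat_ren)
  show ?thesis
    using ZF unfolding ZF_model_def P by blast
qed

lemma replacement:
  assumes "dfn (\<lambda>v. v 0 = F (v (Suc 0)))"
  shows "\<exists>u. \<forall>z. z \<epsilon> u \<longleftrightarrow> (\<exists>y. y \<epsilon> x \<and> z = F y)"
proof -
  obtain p f w where p: "\<forall>v. v 0 = F (v (Suc 0)) \<longleftrightarrow>
      sat mem p (\<lambda>i. case f i of None \<Rightarrow> w i | Some j \<Rightarrow> v j)"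
    using assms unfolding dfn_def by (elim exE) (rule that)
  \<comment> \<open>The axiom puts the argument at index 0 and the value at index 1, whereas the
    graph of \<open>F\<close> has the value first. Hence the swap; parameters start at index
    2.\<close>
  define q where "q = ren p (\<lambda>i. case f i of None \<Rightarrow> Suc (Suc i) | Some 0 \<Rightarrow> Suc 0 | _ \<Rightarrow> 0)"
  have 1: "z = F y \<longleftrightarrow> sat mem p (\<lambda>i. case f i of None \<Rightarrow> w i | Some j \<Rightarrow> case_nat z (\<lambda>_. y) j)" for y z
    using p[rule_format, of "case_nat z (\<lambda>_. y)"] by simp
  have 2: "(\<lambda>i. case f i of None \<Rightarrow> w i | Some j \<Rightarrow> case_nat z (\<lambda>_. y) j) =
     (\<lambda>i. case_nat y (case_nat z w)
        (case f i of None \<Rightarrow> Suc (Suc i) | Some 0 \<Rightarrow> Suc 0 | _ \<Rightarrow> 0))" for y z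
    by (auto split: option.split nat.split)
  have P: "z = F y \<longleftrightarrow> sat mem q (case_nat y (case_nat z w))" for y z
    unfolding 1 2 by (simp add: sat_ren q_def)
  have "(\<forall>y z z'. y \<epsilon> x \<and> sat mem q (case_nat y (case_nat z w))
            \<and> sat mem q (case_nat y (case_nat z' w)) \<longrightarrow> z = z') \<longrightarrow>
        (\<exists>u. \<forall>z. z \<epsilon> u \<longleftrightarrow> (\<exists>y. y \<epsilon> x \<and> sat mem q (case_nat y (case_nat z w))))"
    using ZF unfolding ZF_model_def by blast
  then show ?thesis unfolding P[symmetric] by blast
qed

section \<open>Pairs, functions and bijections in the model\<close>

lemma tm_apply: "tm (\<lambda>v. F (v 0)) \<Longrightarrow> tm a \<Longrightarrow> tm (\<lambda>v. F (a v))"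
  using tm_subst1[where F = F] unfolding tm_def by blast

lemma tm_apply2: "tm (\<lambda>v. F (v 0) (v (Suc 0))) \<Longrightarrow> tm a \<Longrightarrow> tm b \<Longrightarrow> tm (\<lambda>v. F (a v) (b v))"
  using tm_subst2[where F = F] unfolding tm_def by blast

text \<open>This and the following rules share a pattern: substitution reduces the claim to
  variables as arguments, where the unfolded definition is decomposed by the closure rules.\<close>

lemma dfn_is_empty: "tm a \<Longrightarrow> dfn (\<lambda>v. is_empty (a v))"
  by (rule dfn_subst1[rotated], assumption, unfold is_empty_def) (intro dfn_intros)

lemma dfn_is_succ: "tm a \<Longrightarrow> tm b \<Longrightarrow> dfn (\<lambda>v. is_succ (a v) (b v))"
  by (rule dfn_subst2[rotated], assumption+, unfold is_succ_def) (intro dfn_intros)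

lemma dfn_is_upair: "tm a \<Longrightarrow> tm b \<Longrightarrow> tm c \<Longrightarrow> dfn (\<lambda>v. is_upair (a v) (b v) (c v))"
  by (rule dfn_subst3[rotated], assumption+, unfold is_upair_def) (intro dfn_intros)

lemma dfn_is_pair: "tm a \<Longrightarrow> tm b \<Longrightarrow> tm c \<Longrightarrow> dfn (\<lambda>v. is_pair (a v) (b v) (c v))"
  by (rule dfn_subst3[rotated], assumption+, unfold is_pair_def) (intro dfn_intros dfn_is_upair)

lemma dfn_maps: "tm a \<Longrightarrow> tm b \<Longrightarrow> tm c \<Longrightarrow> dfn (\<lambda>v. maps (a v) (b v) (c v))"
  by (rule dfn_subst3[rotated], assumption+, unfold maps_def) (intro dfn_intros dfn_is_pair)

lemma dfn_is_function: "tm a \<Longrightarrow> tm b \<Longrightarrow> tm c \<Longrightarrow> dfn (\<lambda>v. is_function (a v) (b v) (c v))"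
  by (rule dfn_subst3[rotated], assumption+, unfold is_function_def)
     (intro dfn_intros dfn_is_pair dfn_maps)

lemma dfn_is_injection: "tm a \<Longrightarrow> tm b \<Longrightarrow> tm c \<Longrightarrow> dfn (\<lambda>v. is_injection (a v) (b v) (c v))"
  by (rule dfn_subst3[rotated], assumption+, unfold is_injection_def)
     (intro dfn_intros dfn_maps dfn_is_function)

lemma dfn_is_bijection: "tm a \<Longrightarrow> tm b \<Longrightarrow> tm c \<Longrightarrow> dfn (\<lambda>v. is_bijection (a v) (b v) (c v))"
  by (rule dfn_subst3[rotated], assumption+, unfold is_bijection_def)
     (intro dfn_intros dfn_maps dfn_is_injection)

lemma dfn_equinumerous: "tm a \<Longrightarrow> tm b \<Longrightarrow> dfn (\<lambda>v. equinumerous (a v) (b v))"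
  by (rule dfn_subst2[rotated], assumption+, unfold equinumerous_def)
     (intro dfn_intros dfn_is_bijection)

lemma dfn_is_inductive: "tm a \<Longrightarrow> dfn (\<lambda>v. is_inductive (a v))"
  by (rule dfn_subst1[rotated], assumption, unfold is_inductive_def)
     (intro dfn_intros dfn_is_empty dfn_is_succ)

lemma dfn_is_nat: "tm a \<Longrightarrow> dfn (\<lambda>v. is_nat (a v))"
  by (rule dfn_subst1[rotated], assumption, unfold is_nat_def) (intro dfn_intros dfn_is_inductive)

lemma dfn_is_moved_set: "tm a \<Longrightarrow> tm b \<Longrightarrow> tm c \<Longrightarrow> dfn (\<lambda>v. is_moved_set (a v) (b v) (c v))"
  by (rule dfn_subst3[rotated], assumption+, unfold is_moved_set_def)
     (intro dfn_intros dfn_maps)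

section \<open>Function symbols for the basic set operations\<close>

definition emp :: 'a where "emp = the1 is_empty"
definition suc :: "'a \<Rightarrow> 'a" where "suc x = the1 (is_succ x)"
definition upair :: "'a \<Rightarrow> 'a \<Rightarrow> 'a" where "upair a b = the1 (is_upair a b)"
definition pair :: "'a \<Rightarrow> 'a \<Rightarrow> 'a" where "pair a b = the1 (is_pair a b)"
definition app :: "'a \<Rightarrow> 'a \<Rightarrow> 'a" where "app f x = the1 (maps f x)"
text \<open>The graph of a class function on \<open>A\<close>, as an element of the model. For
  definable \<open>F\<close> replacement guarantees that it exists.\<close>

definition lam :: "'a \<Rightarrow> ('a \<Rightarrow> 'a) \<Rightarrow> 'a" where
  "lam A F = the1 (\<lambda>f. \<forall>p. p \<epsilon> f \<longleftrightarrow> (\<exists>x. x \<epsilon> A \<and> p = pair x (F x)))"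

lemma tm_suc: "tm a \<Longrightarrow> tm (\<lambda>v. suc (a v))"
  unfolding suc_def
  by (rule tm_subst1[rotated], assumption) (intro dfn_intros dfn_is_succ)

lemma tm_pair: "tm a \<Longrightarrow> tm b \<Longrightarrow> tm (\<lambda>v. pair (a v) (b v))"
  unfolding pair_def
  by (rule tm_subst2[rotated], assumption+) (intro dfn_intros dfn_is_pair)

lemma tm_app: "tm a \<Longrightarrow> tm b \<Longrightarrow> tm (\<lambda>v. app (a v) (b v))"
  unfolding app_def
  by (rule tm_subst2[rotated], assumption+) (intro dfn_intros dfn_maps)

lemma tm_lam:
  assumes "tm a" "tm (\<lambda>v. F (\<lambda>i. v (Suc i)) (v 0))"
  shows "tm (\<lambda>v. lam (a v) (F v))"
proof -
  \<comment> \<open>In \<open>lam\<close>, \<open>F\<close> stands below the binders of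
    \<open>f\<close>, \<open>p\<close> and \<open>x\<close>, so its environment is shifted by
    three.\<close>
  have "tm (\<lambda>v. F (\<lambda>i. v (Suc (Suc (Suc i)))) (v 0))"
    using tm_ren[OF assms(2), of "case_nat 0 (\<lambda>i. Suc (Suc (Suc i)))"] by simp
  then show ?thesis
    unfolding lam_def by (intro dfn_intros tm_pair tm_ren[OF assms(1)])
qed

lemmas tm_intros = tm_suc tm_pair tm_app tm_lam
lemmas dfn_set = dfn_intros tm_intros dfn_is_empty dfn_is_succ dfn_is_pair dfn_maps dfn_is_function
  dfn_is_injection dfn_is_bijection dfn_equinumerous dfn_is_nat dfn_is_moved_set

text \<open>Here and below a defining relation turns into an equation: an axiom gives existence and
  extensionality gives uniqueness.\<close>

lemma is_empty_iff: "is_empty x \<longleftrightarrow> x = emp"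
proof -
  obtain u where "\<forall>z. z \<epsilon> u \<longleftrightarrow> z \<epsilon> x \<and> False"
    using separation[of "\<lambda>_. False", OF dfn_const] by blast
  then have u: "is_empty u" by (simp add: is_empty_def)
  have eq: "y = u" if "is_empty y" for y
    by (rule ext) (use u that in \<open>simp add: is_empty_def\<close>)
  have "emp = u" unfolding emp_def by (intro the1_eq u eq)
  then show ?thesis using u eq by blast
qed

lemma not_mem_emp [simp]: "\<not> z \<epsilon> emp"
  using is_empty_iff[of emp] by (simp add: is_empty_def)

lemma is_upair_iff: "is_upair a b u \<longleftrightarrow> u = upair a b"
proof -
  have "\<exists>u. \<forall>z. z \<epsilon> u \<longleftrightarrow> z = a \<or> z = b"
    using ZF unfolding ZF_model_def by simp
  then obtain u where u: "is_upair a b u" unfolding is_upair_def by blast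
  have eq: "y = u" if "is_upair a b y" for y
    by (rule ext) (use u that in \<open>simp add: is_upair_def\<close>)
  have "upair a b = u" unfolding upair_def by (intro the1_eq u eq)
  then show ?thesis using u eq by blast
qed

lemma mem_upair [simp]: "z \<epsilon> upair a b \<longleftrightarrow> z = a \<or> z = b"
  using is_upair_iff[of a b "upair a b"] by (simp add: is_upair_def)

lemma union_exists: "\<exists>u. \<forall>z. z \<epsilon> u \<longleftrightarrow> (\<exists>y. y \<epsilon> x \<and> z \<epsilon> y)"
  using ZF unfolding ZF_model_def by simp

lemma power_exists: "\<exists>u. \<forall>z. z \<epsilon> u \<longleftrightarrow> (\<forall>w. w \<epsilon> z \<longrightarrow> w \<epsilon> x)"
  using ZF unfolding ZF_model_def by simp

lemma is_succ_iff: "is_succ x s \<longleftrightarrow> s = suc x"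
proof -
  \<comment> \<open>The successor is the union of the pair of \<open>x\<close> and its
    singleton.\<close>
  obtain u where "\<forall>z. z \<epsilon> u \<longleftrightarrow> (\<exists>y. y \<epsilon> upair x (upair x x) \<and> z \<epsilon> y)"
    using union_exists by blast
  then have u: "is_succ x u" unfolding is_succ_def by auto
  have eq: "y = u" if "is_succ x y" for y
    by (rule ext) (use u that in \<open>simp add: is_succ_def\<close>)
  have "suc x = u" unfolding suc_def by (intro the1_eq u eq)
  then show ?thesis using u eq by blast
qed

lemma mem_suc [simp]: "z \<epsilon> suc x \<longleftrightarrow> z \<epsilon> x \<or> z = x"
  using is_succ_iff[of x "suc x"] by (simp add: is_succ_def)

lemma is_pair_iff: "is_pair a b p \<longleftrightarrow> p = pair a b"
proof -
  have eq: "is_pair a b p \<longleftrightarrow> p = upair (upair a a) (upair a b)" for p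
    by (auto simp: is_pair_def is_upair_iff)
  then show ?thesis unfolding pair_def by (subst the1_eq[of _ "upair (upair a a) (upair a b)"]) auto
qed

lemma upair_eq_iff: "upair a b = upair c d \<longleftrightarrow> a = c \<and> b = d \<or> a = d \<and> b = c"
proof
  assume "upair a b = upair c d"
  then have "z = a \<or> z = b \<longleftrightarrow> z = c \<or> z = d" for z
    by (metis mem_upair)
  then show "a = c \<and> b = d \<or> a = d \<and> b = c" by metis
qed (auto intro: ext)

lemma pair_eq_iff [simp]: "pair a b = pair c d \<longleftrightarrow> a = c \<and> b = d"
proof -
  have "pair x y = upair (upair x x) (upair x y)" for x y
    using is_pair_iff[of x y "pair x y"] by (auto simp: is_pair_def is_upair_iff)
  then show ?thesis by (auto simp: upair_eq_iff)
qed

lemma maps_iff: "maps f a b \<longleftrightarrow> pair a b \<epsilon> f"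
  by (auto simp: maps_def is_pair_iff)

text \<open>Replacement along \<open>B\<close> yields each slice with fixed first component,
  replacement along \<open>A\<close> collects the slices, and their union is the product.\<close>

lemma product_exists: "\<exists>u. \<forall>p. p \<epsilon> u \<longleftrightarrow> (\<exists>a b. a \<epsilon> A \<and> b \<epsilon> B \<and> p = pair a b)"
proof -
  have slice: "\<exists>u. \<forall>p. p \<epsilon> u \<longleftrightarrow> (\<exists>b. b \<epsilon> B \<and> p = pair a b)" for a
    by (rule replacement) (intro dfn_set)
  define S where "S a = the1 (\<lambda>u. \<forall>p. p \<epsilon> u \<longleftrightarrow> (\<exists>b. b \<epsilon> B \<and> p = pair a b))" for a
  have "\<exists>!u. \<forall>p. p \<epsilon> u \<longleftrightarrow> (\<exists>b. b \<epsilon> B \<and> p = pair a b)" for a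
    using slice[of a] by (auto intro: ext)
  from the1I[OF this] have S: "p \<epsilon> S a \<longleftrightarrow> (\<exists>b. b \<epsilon> B \<and> p = pair a b)" for p a
    unfolding S_def by blast
  have "dfn (\<lambda>v. v 0 = S (v (Suc 0)))" unfolding S_def by (intro dfn_set)
  from replacement[OF this, of A] obtain Q where Q: "\<forall>z. z \<epsilon> Q \<longleftrightarrow> (\<exists>a. a \<epsilon> A \<and> z = S a)" by blast
  obtain u where u: "\<forall>p. p \<epsilon> u \<longleftrightarrow> (\<exists>y. y \<epsilon> Q \<and> p \<epsilon> y)" using union_exists by blast
  have "p \<epsilon> u \<longleftrightarrow> (\<exists>a b. a \<epsilon> A \<and> b \<epsilon> B \<and> p = pair a b)" for p
    using u Q S by metis
  then show ?thesis by blast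
qed

lemma is_function_iff:
  "is_function f A B \<longleftrightarrow> (\<forall>p. p \<epsilon> f \<longleftrightarrow> (\<exists>x. x \<epsilon> A \<and> p = pair x (app f x))) \<and>
     (\<forall>x. x \<epsilon> A \<longrightarrow> app f x \<epsilon> B)" (is "_ \<longleftrightarrow> ?R")
proof
  assume f: "is_function f A B"
  then have sub: "\<exists>a b. a \<epsilon> A \<and> b \<epsilon> B \<and> p = pair a b" if "p \<epsilon> f" for p
    using that by (auto simp: is_function_def is_pair_iff)
  have "\<exists>!b. maps f x b" if "x \<epsilon> A" for x
    using f that by (auto simp: is_function_def)
  then have app: "pair x (app f x) \<epsilon> f" "\<And>y. pair x y \<epsilon> f \<Longrightarrow> y = app f x" if "x \<epsilon> A" for x
    using that the1I[of "maps f x"] unfolding app_def maps_iff by blast+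
  show ?R
  proof (intro conjI allI impI iffI)
    fix p assume "p \<epsilon> f"
    then show "\<exists>x. x \<epsilon> A \<and> p = pair x (app f x)" using sub app by metis
  next
    fix p assume "\<exists>x. x \<epsilon> A \<and> p = pair x (app f x)"
    then show "p \<epsilon> f" using app by auto
  next
    fix x assume "x \<epsilon> A"
    then show "app f x \<epsilon> B" using sub[of "pair x (app f x)"] app by auto
  qed
next
  assume ?R
  then show "is_function f A B"
    unfolding is_function_def maps_iff is_pair_iff by auto
qed

lemma maps_app: "is_function f A B \<Longrightarrow> maps f x y \<longleftrightarrow> x \<epsilon> A \<and> y = app f x"
  by (auto simp: is_function_iff maps_iff)

lemma app_in: "is_function f A B \<Longrightarrow> x \<epsilon> A \<Longrightarrow> app f x \<epsilon> B"
  by (simp add: is_function_iff)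

lemma function_ext:
  assumes "is_function f A B" "is_function g A C" "\<And>x. x \<epsilon> A \<Longrightarrow> app f x = app g x"
  shows "f = g"
  by (rule ext) (use assms in \<open>auto simp: is_function_iff\<close>)

lemma mem_lam:
  assumes "tm (\<lambda>v. F (v 0))"
  shows "p \<epsilon> lam A F \<longleftrightarrow> (\<exists>x. x \<epsilon> A \<and> p = pair x (F x))"
proof -
  have "\<exists>u. \<forall>p. p \<epsilon> u \<longleftrightarrow> (\<exists>x. x \<epsilon> A \<and> p = pair x (F x))"
    by (rule replacement) (intro dfn_set tm_apply[OF assms])
  then have "\<exists>!u. \<forall>p. p \<epsilon> u \<longleftrightarrow> (\<exists>x. x \<epsilon> A \<and> p = pair x (F x))" by (auto intro: ext)
  from the1I[OF this] show ?thesis unfolding lam_def by blast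
qed

lemma app_lam: "tm (\<lambda>v. F (v 0)) \<Longrightarrow> x \<epsilon> A \<Longrightarrow> app (lam A F) x = F x"
  unfolding app_def by (rule the1_eq) (auto simp: maps_iff mem_lam)

lemma lam_function:
  "tm (\<lambda>v. F (v 0)) \<Longrightarrow> (\<And>x. x \<epsilon> A \<Longrightarrow> F x \<epsilon> B) \<Longrightarrow> is_function (lam A F) A B"
  by (auto simp: is_function_iff mem_lam app_lam)

text \<open>Passing to the collection of elements of \<open>A\<close> makes the library facts on
  \<open>inj_on\<close>, and next on \<open>bij_betw\<close>, available for functions of the
  model.\<close>

lemma is_injection_iff:
  "is_injection f A B \<longleftrightarrow> is_function f A B \<and> inj_on (app f) {x. x \<epsilon> A}"
  by (auto simp: is_injection_def inj_on_def maps_app)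

lemma is_bijection_iff:
  "is_bijection f A B \<longleftrightarrow> is_function f A B \<and> bij_betw (app f) {x. x \<epsilon> A} {x. x \<epsilon> B}"
proof (cases "is_function f A B")
  case True
  then show ?thesis
    using app_in[OF True]
    by (auto simp: is_bijection_def is_injection_iff bij_betw_def maps_app image_iff)
qed (simp add: is_bijection_def is_injection_def)

lemma tm_app_var: "tm (\<lambda>v. app f (v 0))"
  by (intro dfn_set)

text \<open>An arbitrary HOL bijection between the elements need not come from the model; a
  definable one does, through \<open>lam\<close>.\<close>

lemma equinumerousI:
  assumes F: "tm (\<lambda>v. F (v 0))" and bij: "bij_betw F {x. x \<epsilon> X} {x. x \<epsilon> Y}"
  shows "equinumerous X Y"
proof -
  have "is_function (lam X F) X Y"
    using bij by (intro lam_function F) (auto simp: bij_betw_def)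
  moreover have "bij_betw (app (lam X F)) {x. x \<epsilon> X} {x. x \<epsilon> Y}"
    using bij by (rule bij_betw_cong[THEN iffD1, rotated]) (simp add: app_lam[OF F])
  ultimately show ?thesis
    by (auto simp: equinumerous_def is_bijection_iff)
qed

lemma equinumerousE:
  assumes "equinumerous X Y"
  obtains F where "tm (\<lambda>v. F (v 0))" "bij_betw F {x. x \<epsilon> X} {x. x \<epsilon> Y}"
  using assms tm_app_var by (auto simp: equinumerous_def is_bijection_iff)

text \<open>The library's \<open>inv_into\<close> is defined by choice and hence not definable.\<close>

lemma definable_inverse:
  assumes F: "tm (\<lambda>v. F (v 0))" and bij: "bij_betw F {x. x \<epsilon> X} {x. x \<epsilon> Y}"
  obtains G where "tm (\<lambda>v. G (v 0))" "bij_betw G {x. x \<epsilon> Y} {x. x \<epsilon> X}"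
    "\<And>x. x \<epsilon> X \<Longrightarrow> G (F x) = x" "\<And>y. y \<epsilon> Y \<Longrightarrow> F (G y) = y"
proof -
  define G where "G y = the1 (\<lambda>x. x \<epsilon> X \<and> F x = y)" for y
  have 1: "tm (\<lambda>v. G (v 0))"
    unfolding G_def by (intro dfn_set tm_apply[OF F])
  have 2: "G (F x) = x" if "x \<epsilon> X" for x
    unfolding G_def using that bij by (intro the1_eq) (auto simp: bij_betw_def inj_on_def)
  have 3: "F (G y) = y \<and> G y \<epsilon> X" if "y \<epsilon> Y" for y
  proof -
    have "y \<in> F ` {x. x \<epsilon> X}" using that bij by (simp add: bij_betw_def)
    then obtain x where "x \<epsilon> X" "y = F x" by blast
    then show ?thesis using 2 by simp
  qed
  have "bij_betw G {x. x \<epsilon> Y} {x. x \<epsilon> X}"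
    using 2 3 bij by (intro bij_betw_byWitness[where f' = F]) (auto simp: bij_betw_def)
  with 1 2 3 that show thesis by blast
qed

lemma equinumerous_sym: "equinumerous X Y \<Longrightarrow> equinumerous Y X"
  by (metis equinumerousE equinumerousI definable_inverse)

section \<open>Natural numbers of the model\<close>

lemma is_inductive_iff: "is_inductive I \<longleftrightarrow> emp \<epsilon> I \<and> (\<forall>y. y \<epsilon> I \<longrightarrow> suc y \<epsilon> I)"
  by (auto simp: is_inductive_def is_empty_iff is_succ_iff)

lemma is_nat_emp: "is_nat emp"
  by (simp add: is_nat_def is_inductive_iff)

lemma is_nat_suc: "is_nat k \<Longrightarrow> is_nat (suc k)"
  by (simp add: is_nat_def is_inductive_iff)

text \<open>The natural numbers with property \<open>P\<close> in some inductive set form an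
  inductive set by separation, hence contain \<open>n\<close>. Separation is the reason why
  \<open>P\<close> must be definable.\<close>

lemma nat_induct [consumes 2, case_names emp suc]:
  assumes "is_nat n" "dfn (\<lambda>v. P (v 0))" "P emp" "\<And>k. is_nat k \<Longrightarrow> P k \<Longrightarrow> P (suc k)"
  shows "P n"
proof -
  obtain I where I: "is_inductive I"
    using ZF unfolding ZF_model_def by (elim conjE exE) (rule that)
  have "dfn (\<lambda>v. is_nat (v 0) \<and> P (v 0))"
    by (intro dfn_set assms(2))
  from separation[OF this, of I] obtain u where u: "\<forall>z. z \<epsilon> u \<longleftrightarrow> z \<epsilon> I \<and> is_nat z \<and> P z" by blast
  have "is_inductive u"
    using I u assms(3,4) is_nat_emp is_nat_suc by (simp add: is_inductive_iff)
  then show ?thesis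
    using assms(1) u unfolding is_nat_def by blast
qed

lemma nat_trans: "is_nat n \<Longrightarrow> y \<epsilon> n \<Longrightarrow> x \<epsilon> y \<Longrightarrow> x \<epsilon> n"
proof -
  assume n: "is_nat n"
  have "dfn (\<lambda>v. \<forall>y x. y \<epsilon> v 0 \<longrightarrow> x \<epsilon> y \<longrightarrow> x \<epsilon> v 0)" by (intro dfn_set)
  with n have "\<forall>y x. y \<epsilon> n \<longrightarrow> x \<epsilon> y \<longrightarrow> x \<epsilon> n" by (induction rule: nat_induct) auto
  then show "y \<epsilon> n \<Longrightarrow> x \<epsilon> y \<Longrightarrow> x \<epsilon> n" by blast
qed

lemma nat_mem: "is_nat n \<Longrightarrow> y \<epsilon> n \<Longrightarrow> is_nat y"
proof -
  assume n: "is_nat n"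
  have "dfn (\<lambda>v. \<forall>y. y \<epsilon> v 0 \<longrightarrow> is_nat y)" by (intro dfn_set)
  with n have "\<forall>y. y \<epsilon> n \<longrightarrow> is_nat y" by (induction rule: nat_induct) auto
  then show "y \<epsilon> n \<Longrightarrow> is_nat y" by blast
qed

text \<open>Foundation, applied to the set of those elements of \<open>a\<close> that satisfy
  \<open>P\<close>.\<close>

lemma minimal_exists:
  assumes "dfn (\<lambda>v. P (v 0))" "x \<epsilon> a" "P x"
  shows "\<exists>y. y \<epsilon> a \<and> P y \<and> (\<forall>z. z \<epsilon> y \<longrightarrow> z \<epsilon> a \<longrightarrow> \<not> P z)"
proof -
  obtain u where u: "\<forall>z. z \<epsilon> u \<longleftrightarrow> z \<epsilon> a \<and> P z" using separation[OF assms(1)] by blast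
  have "(\<exists>y. y \<epsilon> u) \<longrightarrow> (\<exists>y. y \<epsilon> u \<and> \<not> (\<exists>z. z \<epsilon> u \<and> z \<epsilon> y))"
    using ZF unfolding ZF_model_def by simp
  then show ?thesis using u assms(2,3) by blast
qed

lemma mem_asym: "x \<epsilon> y \<Longrightarrow> \<not> y \<epsilon> x"
  using minimal_exists[of "\<lambda>_. True" x "upair x y", OF dfn_const] by auto

lemma not_mem_self [simp]: "\<not> x \<epsilon> x"
  using mem_asym by blast

text \<open>If \<open>x\<close> and \<open>y\<close> differed, each would be an element of the
  other.\<close>

lemma suc_inject [simp]: "suc x = suc y \<longleftrightarrow> x = y"
  using mem_asym mem_suc by metis

lemma nat_cases:
  assumes "is_nat n"
  obtains "n = emp" | k where "is_nat k" "n = suc k"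
proof -
  have "dfn (\<lambda>v. v 0 = emp \<or> (\<exists>k. is_nat k \<and> v 0 = suc k))" by (intro dfn_set)
  with assms have "n = emp \<or> (\<exists>k. is_nat k \<and> n = suc k)" by (induction rule: nat_induct) auto
  then show thesis using that by blast
qed

lemma emp_mem_nat: "is_nat n \<Longrightarrow> n = emp \<or> emp \<epsilon> n"
proof -
  assume n: "is_nat n"
  have "dfn (\<lambda>v. v 0 = emp \<or> emp \<epsilon> v 0)" by (intro dfn_set)
  with n show ?thesis by (induction rule: nat_induct) auto
qed

lemma suc_mem_nat: "is_nat n \<Longrightarrow> k \<epsilon> n \<Longrightarrow> suc k \<epsilon> n \<or> suc k = n"
proof -
  assume n: "is_nat n"
  have "dfn (\<lambda>v. \<forall>k. k \<epsilon> v 0 \<longrightarrow> suc k \<epsilon> v 0 \<or> suc k = v 0)" by (intro dfn_set)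
  with n have "\<forall>k. k \<epsilon> n \<longrightarrow> suc k \<epsilon> n \<or> suc k = n" by (induction rule: nat_induct) auto
  then show "k \<epsilon> n \<Longrightarrow> suc k \<epsilon> n \<or> suc k = n" by blast
qed

lemma nat_linear: "is_nat k \<Longrightarrow> is_nat n \<Longrightarrow> k \<epsilon> n \<or> k = n \<or> n \<epsilon> k"
proof -
  assume k: "is_nat k" and n: "is_nat n"
  have "dfn (\<lambda>v. v 0 \<epsilon> n \<or> v 0 = n \<or> n \<epsilon> v 0)" by (intro dfn_set)
  with k show ?thesis
  proof (induction rule: nat_induct)
    case emp
    then show ?case using emp_mem_nat[OF n] by auto
  next
    case (suc k)
    then show ?case using suc_mem_nat[OF n] by auto
  qed
qed

text \<open>Transitivity of \<open>a\<close> makes a minimal element least, and linearity makes it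
  unique. With uniqueness \<open>the1\<close> can select it, which replaces any appeal to
  choice.\<close>

lemma least_unique:
  assumes "is_nat a" "dfn (\<lambda>v. P (v 0))" "x \<epsilon> a" "P x"
  shows "\<exists>!y. y \<epsilon> a \<and> P y \<and> (\<forall>z. z \<epsilon> y \<longrightarrow> \<not> P z)"
proof -
  obtain y where y: "y \<epsilon> a" "P y" "\<forall>z. z \<epsilon> y \<longrightarrow> z \<epsilon> a \<longrightarrow> \<not> P z"
    using minimal_exists[OF assms(2-4)] by blast
  show ?thesis
  proof (rule ex1I)
    show *: "y \<epsilon> a \<and> P y \<and> (\<forall>z. z \<epsilon> y \<longrightarrow> \<not> P z)"
      using y nat_trans[OF assms(1)] by blast
    show "y' = y" if "y' \<epsilon> a \<and> P y' \<and> (\<forall>z. z \<epsilon> y' \<longrightarrow> \<not> P z)" for y'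
      using that * nat_linear nat_mem[OF assms(1)] by blast
  qed
qed

section \<open>The pigeonhole principle inside the model\<close>

lemma nat_injection_surj:
  assumes n: "is_nat n" and F: "tm (\<lambda>v. F (v 0))"
    and inj: "inj_on F {x. x \<epsilon> n}" and into: "\<And>x. x \<epsilon> n \<Longrightarrow> F x \<epsilon> n" and y: "y \<epsilon> n"
  shows "\<exists>x. x \<epsilon> n \<and> F x = y"
proof -
  \<comment> \<open>The induction ranges over injections that are sets of the model, since a formula
    cannot quantify over class functions.\<close>
  have "dfn (\<lambda>v. \<forall>f. is_injection f (v 0) (v 0) \<longrightarrow> is_bijection f (v 0) (v 0))"
    by (intro dfn_set)
  with n have step: "\<forall>f. is_injection f n n \<longrightarrow> is_bijection f n n"
  proof (induction rule: nat_induct)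
    case emp
    then show ?case by (simp add: is_bijection_def)
  next
    case (suc k)
    show ?case
    proof (intro allI impI)
      fix f assume f: "is_injection f (suc k) (suc k)"
      then have fn: "is_function f (suc k) (suc k)" by (simp add: is_injection_def)
      have inj: "x = x'" if "app f x = app f x'" "x \<epsilon> suc k" "x' \<epsilon> suc k" for x x'
        using f that by (auto simp: is_injection_iff inj_on_def)
      \<comment> \<open>Whenever \<open>f\<close> takes the value \<open>k\<close>, it is redirected
        to the value of \<open>f\<close> at \<open>k\<close>. This gives an injection of
        \<open>k\<close> into itself, to which the induction hypothesis applies.\<close>
      define G where "G x = (if app f x = k then app f k else app f x)" for x
      have G: "tm (\<lambda>v. G (v 0))" unfolding G_def by (intro dfn_set)
      have "is_function (lam k G) k k"
      proof (rule lam_function[OF G])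
        fix x assume "x \<epsilon> k"
        then show "G x \<epsilon> k"
          using app_in[OF fn, of x] app_in[OF fn, of k] inj[of x k] by (auto simp: G_def)
      qed
      moreover have "inj_on G {x. x \<epsilon> k}"
      proof (rule inj_onI)
        fix x x' assume "x \<in> {x. x \<epsilon> k}" "x' \<in> {x. x \<epsilon> k}" "G x = G x'"
        then show "x = x'" using inj[of x x'] inj[of x k] inj[of k x']
          by (auto simp: G_def split: if_splits)
      qed
      then have "inj_on (app (lam k G)) {x. x \<epsilon> k}"
        by (simp add: inj_on_def app_lam[OF G])
      ultimately have "is_bijection (lam k G) k k"
        using suc by (simp add: is_injection_iff)
      then have "{y. y \<epsilon> k} = app (lam k G) ` {x. x \<epsilon> k}"
        by (simp add: is_bijection_iff bij_betw_def)
      then have surj: "\<exists>x. x \<epsilon> k \<and> G x = y" if "y \<epsilon> k" for y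
        using that app_lam[OF G] by force
      have "\<exists>x. x \<epsilon> suc k \<and> app f x = y" if "y \<epsilon> suc k" for y
      proof (cases "y = k")
        case True
        show ?thesis
        proof (cases "app f k = k")
          case False
          then have "app f k \<epsilon> k" using app_in[OF fn, of k] by auto
          then obtain x where x: "x \<epsilon> k" "G x = app f k" using surj by blast
          \<comment> \<open>Otherwise \<open>f\<close> would agree at \<open>x\<close> and
            \<open>k\<close>, contrary to injectivity.\<close>
          then have "app f x = k" using inj[of x k] by (auto simp: G_def split: if_splits)
          then show ?thesis using x True by auto
        qed (use True in auto)
      next
        case False
        then have "y \<epsilon> k" using that by simp
        then obtain x where "x \<epsilon> k" "G x = y" using surj by blast
        then show ?thesis by (auto simp: G_def split: if_splits)
      qed
      then show "is_bijection f (suc k) (suc k)"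
        using f unfolding is_bijection_def maps_app[OF fn] by blast
    qed
  qed
  have "is_injection (lam n F) n n"
    using inj by (auto simp: is_injection_iff inj_on_def app_lam[OF F] intro!: lam_function[OF F] into)
  with step have "is_bijection (lam n F) n n" by blast
  then have "{y. y \<epsilon> n} = app (lam n F) ` {x. x \<epsilon> n}"
    by (simp add: is_bijection_iff bij_betw_def)
  then show ?thesis using y app_lam[OF F] by force
qed

lemma equinumerous_nat_injection_surj:
  assumes n: "is_nat n" and D: "equinumerous D n" and F: "tm (\<lambda>v. F (v 0))"
    and inj: "inj_on F {x. x \<epsilon> n}" and into: "\<And>x. x \<epsilon> n \<Longrightarrow> F x \<epsilon> D" and y: "y \<epsilon> D"
  shows "\<exists>x. x \<epsilon> n \<and> F x = y"
proof -
  obtain G where G: "tm (\<lambda>v. G (v 0))" "bij_betw G {x. x \<epsilon> D} {x. x \<epsilon> n}"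
    using D by (rule equinumerousE)
  then have Gin: "G x \<epsilon> n" if "x \<epsilon> D" for x using that by (auto simp: bij_betw_def)
  have Ginj: "x = x'" if "G x = G x'" "x \<epsilon> D" "x' \<epsilon> D" for x x'
    using that G(2) by (auto simp: bij_betw_def inj_on_def)
  have "\<exists>x. x \<epsilon> n \<and> G (F x) = G y"
  proof (rule nat_injection_surj[OF n])
    show "tm (\<lambda>v. G (F (v 0)))" by (intro tm_apply[OF G(1)] F)
    show "inj_on (\<lambda>x. G (F x)) {x. x \<epsilon> n}"
      using inj Ginj into by (auto simp: inj_on_def)
  qed (use Gin into y in auto)
  then show ?thesis using Ginj into y by blast
qed

text \<open>Such an \<open>F\<close> would be an injection of \<open>suc n\<close> into itself that
  misses \<open>n\<close>.\<close>

lemma pigeonhole: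
  assumes "is_nat n" "tm (\<lambda>v. F (v 0))" "inj_on F {x. x \<epsilon> suc n}" "\<And>x. x \<epsilon> suc n \<Longrightarrow> F x \<epsilon> n"
  shows False
  using nat_injection_surj[OF is_nat_suc[OF assms(1)] assms(2,3), of n] assms(4) by force

text \<open>Number the points of \<open>D\<close> by \<open>n\<close>. If every row met
  \<open>D\<close>, sending a row to the least number of a point of \<open>D\<close> on it would
  inject \<open>suc n\<close> into \<open>n\<close>, because the rows are disjoint.\<close>

lemma free_row_exists:
  assumes n: "is_nat n" and D: "equinumerous D n" and h: "tm (\<lambda>v. h (v 0) (v (Suc 0)))"
    and inj: "\<And>i j i' j'. i \<epsilon> suc n \<Longrightarrow> i' \<epsilon> suc n \<Longrightarrow> j \<epsilon> r \<Longrightarrow> j' \<epsilon> r \<Longrightarrow> h i j = h i' j' \<Longrightarrow> i = i'"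
  shows "\<exists>i. i \<epsilon> suc n \<and> (\<forall>j. j \<epsilon> r \<longrightarrow> \<not> h i j \<epsilon> D)"
proof (rule ccontr)
  assume "\<not> ?thesis"
  then have hit: "\<exists>j. j \<epsilon> r \<and> h i j \<epsilon> D" if "i \<epsilon> suc n" for i using that by blast
  obtain G where G: "tm (\<lambda>v. G (v 0))" "bij_betw G {x. x \<epsilon> D} {x. x \<epsilon> n}"
    using D by (rule equinumerousE)
  define P where "P i y \<longleftrightarrow> (\<exists>j. j \<epsilon> r \<and> h i j \<epsilon> D \<and> G (h i j) = y)" for i y
  define F where "F i = the1 (\<lambda>y. y \<epsilon> n \<and> P i y \<and> (\<forall>z. z \<epsilon> y \<longrightarrow> \<not> P i z))" for i
  have F: "F i \<epsilon> n \<and> P i (F i)" if i: "i \<epsilon> suc n" for i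
  proof -
    obtain j where j: "j \<epsilon> r" "h i j \<epsilon> D" using hit[OF i] by blast
    have "dfn (\<lambda>v. P i (v 0))"
      unfolding P_def by (intro dfn_set tm_apply[OF G(1)] tm_apply2[OF h])
    moreover have "G (h i j) \<epsilon> n" using j G(2) by (auto simp: bij_betw_def)
    moreover have "P i (G (h i j))" using j by (auto simp: P_def)
    ultimately have "\<exists>!y. y \<epsilon> n \<and> P i y \<and> (\<forall>z. z \<epsilon> y \<longrightarrow> \<not> P i z)"
      by (rule least_unique[OF n])
    from the1I[OF this] show ?thesis unfolding F_def by blast
  qed
  show False
  proof (rule pigeonhole[OF n])
    show "tm (\<lambda>v. F (v 0))"
      unfolding F_def P_def by (intro dfn_set tm_apply[OF G(1)] tm_apply2[OF h])
    show "inj_on F {x. x \<epsilon> suc n}"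
    proof (rule inj_onI)
      fix i i' assume i: "i \<in> {x. x \<epsilon> suc n}" "i' \<in> {x. x \<epsilon> suc n}" "F i = F i'"
      then obtain j j' where "j \<epsilon> r" "j' \<epsilon> r" "h i j \<epsilon> D" "h i' j' \<epsilon> D" "G (h i j) = G (h i' j')"
        using F[of i] F[of i'] unfolding P_def by auto
      then have "h i j = h i' j'" using G(2) by (auto simp: bij_betw_def inj_on_def)
      then show "i = i'" using inj i \<open>j \<epsilon> r\<close> \<open>j' \<epsilon> r\<close> by blast
    qed
  qed (use F in blast)
qed

section \<open>Grids in an infinite set\<close>

lemma nat_injects_infinite:
  assumes A: "is_infinite A" and q: "is_nat q"
  shows "\<exists>f. is_injection f q A"
proof -
  have "dfn (\<lambda>v. \<exists>f. is_injection f (v 0) A)" by (intro dfn_set)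
  with q show ?thesis
  proof (induction rule: nat_induct)
    case emp
    have "is_injection emp emp A" by (simp add: is_injection_iff is_function_iff)
    then show ?case by blast
  next
    case (suc k)
    then obtain f where f: "is_injection f k A" by blast
    then have fn: "is_function f k A" by (simp add: is_injection_def)
    \<comment> \<open>Infinity of \<open>A\<close> leaves a point outside the range, which becomes
      the value at \<open>k\<close>. The induction asserts mere existence of an injection, so no
      sequence of choices is made.\<close>
    have "\<not> is_bijection f k A"
    proof
      assume "is_bijection f k A"
      then have "equinumerous A k" using equinumerous_sym by (auto simp: equinumerous_def)
      with A suc show False by (auto simp: is_infinite_def)
    qed
    then obtain a where a: "a \<epsilon> A" "\<And>x. x \<epsilon> k \<Longrightarrow> app f x \<noteq> a"
      using f by (auto simp: is_bijection_def maps_app[OF fn])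
    define F where "F x = (if x = k then a else app f x)" for x
    have F: "tm (\<lambda>v. F (v 0))" unfolding F_def by (intro dfn_set)
    have "is_function (lam (suc k) F) (suc k) A"
      using a app_in[OF fn] by (intro lam_function[OF F]) (auto simp: F_def)
    moreover have "inj_on F {x. x \<epsilon> suc k}"
      using f a by (auto simp: inj_on_def F_def is_injection_iff)
    then have "inj_on (app (lam (suc k) F)) {x. x \<epsilon> suc k}"
      by (simp add: inj_on_def app_lam[OF F])
    ultimately show ?case by (auto simp: is_injection_iff)
  qed
qed

text \<open>A new point gets the value \<open>q\<close>, which is not an element of
  \<open>q\<close>; if \<open>x\<close> already lies in \<open>X\<close>, all values stay the
  same.\<close>

lemma injection_insert:
  assumes f: "is_injection f X q"
  shows "\<exists>X' f'. is_injection f' X' (suc q) \<and> (\<forall>z. z \<epsilon> X' \<longleftrightarrow> z \<epsilon> X \<or> z = x)"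
proof -
  obtain X' where "\<forall>z. z \<epsilon> X' \<longleftrightarrow> (\<exists>y. y \<epsilon> upair X (upair x x) \<and> z \<epsilon> y)"
    using union_exists by blast
  then have X': "z \<epsilon> X' \<longleftrightarrow> z \<epsilon> X \<or> z = x" for z by auto
  have fn: "is_function f X q" using f by (simp add: is_injection_def)
  define F where "F p = (if p \<epsilon> X then app f p else q)" for p
  have F: "tm (\<lambda>v. F (v 0))" unfolding F_def by (intro dfn_set)
  have "is_function (lam X' F) X' (suc q)"
    using app_in[OF fn] by (intro lam_function[OF F]) (auto simp: F_def)
  moreover have "inj_on F {x. x \<epsilon> X'}"
  proof (rule inj_onI)
    fix y z assume "y \<in> {x. x \<epsilon> X'}" "z \<in> {x. x \<epsilon> X'}" "F y = F z"
    then show "y = z"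
      using f app_in[OF fn, of y] app_in[OF fn, of z]
      by (auto simp: F_def is_injection_iff inj_on_def X' split: if_splits)
  qed
  then have "inj_on (app (lam X' F)) {x. x \<epsilon> X'}"
    by (simp add: inj_on_def app_lam[OF F])
  ultimately have "is_injection (lam X' F) X' (suc q)" by (simp add: is_injection_iff)
  with X' show ?thesis by blast
qed

text \<open>Multiplication is avoided: it suffices that the product injects into some natural
  number. The outer induction adds rows, the inner one adds the cells of the new row one by
  one.\<close>

lemma grid_injects_nat:
  assumes k: "is_nat k" and m: "is_nat m"
  shows "\<exists>X q f. is_nat q \<and> is_injection f X q \<and>
           (\<forall>p. p \<epsilon> X \<longleftrightarrow> (\<exists>i j. p = pair i j \<and> i \<epsilon> k \<and> j \<epsilon> m))"
proof -
  have "dfn (\<lambda>v. \<exists>X q f. is_nat q \<and> is_injection f X q \<and>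
           (\<forall>p. p \<epsilon> X \<longleftrightarrow> (\<exists>i j. p = pair i j \<and> i \<epsilon> v 0 \<and> j \<epsilon> m)))" by (intro dfn_set)
  with k show ?thesis
  proof (induction rule: nat_induct)
    case emp
    have "is_injection emp emp emp" by (simp add: is_injection_iff is_function_iff)
    then show ?case using is_nat_emp not_mem_emp by blast
  next
    case (suc k)
    have "dfn (\<lambda>v. \<exists>X q f. is_nat q \<and> is_injection f X q \<and>
           (\<forall>p. p \<epsilon> X \<longleftrightarrow> (\<exists>i j. p = pair i j \<and> (i \<epsilon> k \<and> j \<epsilon> m \<or> i = k \<and> j \<epsilon> v 0))))"
      by (intro dfn_set)
    with m have "\<exists>X q f. is_nat q \<and> is_injection f X q \<and>
           (\<forall>p. p \<epsilon> X \<longleftrightarrow> (\<exists>i j. p = pair i j \<and> (i \<epsilon> k \<and> j \<epsilon> m \<or> i = k \<and> j \<epsilon> m)))"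
    proof (induction rule: nat_induct)
      case emp
      then show ?case using suc by simp
    next
      case (suc l)
      then obtain X q f where "is_nat q" "is_injection f X q" and X:
        "\<forall>p. p \<epsilon> X \<longleftrightarrow> (\<exists>i j. p = pair i j \<and> (i \<epsilon> k \<and> j \<epsilon> m \<or> i = k \<and> j \<epsilon> l))" by blast
      moreover obtain X' f' where "is_injection f' X' (suc q)"
        and X': "\<forall>z. z \<epsilon> X' \<longleftrightarrow> z \<epsilon> X \<or> z = pair k l"
        using injection_insert[OF \<open>is_injection f X q\<close>] by blast
      moreover have "\<forall>p. p \<epsilon> X' \<longleftrightarrow>
          (\<exists>i j. p = pair i j \<and> (i \<epsilon> k \<and> j \<epsilon> m \<or> i = k \<and> j \<epsilon> suc l))"
        unfolding X'[rule_format] X[rule_format] mem_suc by blast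
      ultimately show ?case using is_nat_suc by blast
    qed
    moreover have "(i \<epsilon> k \<and> j \<epsilon> m \<or> i = k \<and> j \<epsilon> m) \<longleftrightarrow> i \<epsilon> suc k \<and> j \<epsilon> m" for i j by auto
    ultimately show ?case by simp
  qed
qed

lemma grid_in_infinite:
  assumes A: "is_infinite A" and k: "is_nat k" and m: "is_nat m"
  obtains h where "tm (\<lambda>v. h (v 0) (v (Suc 0)))" "\<And>i j. i \<epsilon> k \<Longrightarrow> j \<epsilon> m \<Longrightarrow> h i j \<epsilon> A"
    "\<And>i j i' j'. i \<epsilon> k \<Longrightarrow> i' \<epsilon> k \<Longrightarrow> j \<epsilon> m \<Longrightarrow> j' \<epsilon> m \<Longrightarrow> h i j = h i' j' \<Longrightarrow> i = i' \<and> j = j'"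
proof -
  obtain X q f where q: "is_nat q" and f: "is_injection f X q"
    and X: "\<forall>p. p \<epsilon> X \<longleftrightarrow> (\<exists>i j. p = pair i j \<and> i \<epsilon> k \<and> j \<epsilon> m)"
    using grid_injects_nat[OF k m] by blast
  obtain g where g: "is_injection g q A" using nat_injects_infinite[OF A q] by blast
  have fX: "is_function f X q" and gq: "is_function g q A"
    using f g by (auto simp: is_injection_def)
  have inX: "pair i j \<epsilon> X" if "i \<epsilon> k" "j \<epsilon> m" for i j
    using X that by blast
  show thesis
  proof (rule that[of "\<lambda>i j. app g (app f (pair i j))"])
    show "tm (\<lambda>v. app g (app f (pair (v 0) (v (Suc 0)))))" by (intro dfn_set)
    show "app g (app f (pair i j)) \<epsilon> A" if "i \<epsilon> k" "j \<epsilon> m" for i j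
      using app_in[OF gq app_in[OF fX inX]] that by blast
    show "i = i' \<and> j = j'" if "i \<epsilon> k" "i' \<epsilon> k" "j \<epsilon> m" "j' \<epsilon> m"
      "app g (app f (pair i j)) = app g (app f (pair i' j'))" for i j i' j'
    proof -
      have "app f (pair i j) = app f (pair i' j')"
        using g that app_in[OF fX inX] by (auto simp: is_injection_iff inj_on_def)
      then have "pair i j = pair i' j'"
        using f that inX unfolding is_injection_iff inj_on_def by blast
      then show ?thesis by simp
    qed
  qed
qed

section \<open>The shift by \<open>n\<close> and the interval from \<open>n\<close> to
  \<open>m\<close>\<close>

lemma sum_shift:
  assumes n: "is_nat n" and sum: "is_sum n n d"
  obtains G where "tm (\<lambda>v. G (v 0))" "inj_on G {x. x \<epsilon> n}"
    "\<And>i. i \<epsilon> n \<Longrightarrow> G i \<epsilon> d \<and> \<not> G i \<epsilon> n" "is_nat d"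
proof -
  obtain g R where g: "is_function g (suc n) R" and g0: "maps g emp n" and gn: "maps g n d"
    and gs: "\<And>i u w. i \<epsilon> n \<Longrightarrow> maps g i u \<Longrightarrow> maps g (suc i) w \<Longrightarrow> w = suc u"
    using sum unfolding is_sum_def is_empty_iff is_succ_iff by blast
  have step: "app g (suc i) = suc (app g i)" if "i \<epsilon> n" for i
    using gs[OF that] suc_mem_nat[OF n that] that by (auto simp: maps_app[OF g])
  have sn: "suc i \<epsilon> suc n \<Longrightarrow> i \<epsilon> n" for i
    using nat_trans[OF n, of "suc i" i] by auto
  \<comment> \<open>The recursion \<open>g\<close> behind the sum maps \<open>i\<close> to
    \<open>n + i\<close>. Its values are at least \<open>n\<close>, and by monotonicity those at
    \<open>i\<close> in \<open>n\<close> stay below \<open>d\<close>. The inductions are restricted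
    to \<open>suc n\<close>, the domain of \<open>g\<close>.\<close>
  have large: "is_nat (app g i) \<and> (n = app g i \<or> n \<epsilon> app g i)" if "i \<epsilon> suc n" for i
  proof -
    have "dfn (\<lambda>v. v 0 \<epsilon> suc n \<longrightarrow> is_nat (app g (v 0)) \<and> (n = app g (v 0) \<or> n \<epsilon> app g (v 0)))"
      by (intro dfn_set)
    with nat_mem[OF is_nat_suc[OF n] that]
    have "i \<epsilon> suc n \<longrightarrow> is_nat (app g i) \<and> (n = app g i \<or> n \<epsilon> app g i)"
    proof (induction rule: nat_induct)
      case emp
      then show ?case using g0 n by (auto simp: maps_app[OF g])
    next
      case (suc k)
      then show ?case using sn[of k] step[of k] is_nat_suc by auto
    qed
    with that show ?thesis by blast
  qed
  have mono: "app g i \<epsilon> app g j" if "i \<epsilon> j" "j \<epsilon> suc n" for i j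
  proof -
    have "dfn (\<lambda>v. v 0 \<epsilon> suc n \<longrightarrow> (\<forall>i. i \<epsilon> v 0 \<longrightarrow> app g i \<epsilon> app g (v 0)))"
      by (intro dfn_set)
    with nat_mem[OF is_nat_suc[OF n] that(2)]
    have "j \<epsilon> suc n \<longrightarrow> (\<forall>i. i \<epsilon> j \<longrightarrow> app g i \<epsilon> app g j)"
    proof (induction rule: nat_induct)
      case emp
      then show ?case by simp
    next
      case (suc k)
      then show ?case using sn[of k] step[of k] by auto
    qed
    with that show ?thesis by blast
  qed
  have d: "d = app g n" using gn by (simp add: maps_app[OF g])
  show thesis
  proof (rule that[of "app g"])
    show "tm (\<lambda>v. app g (v 0))" by (rule tm_app_var)
    show "inj_on (app g) {x. x \<epsilon> n}"
    proof (rule inj_onI)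
      fix x y assume xy: "x \<in> {x. x \<epsilon> n}" "y \<in> {x. x \<epsilon> n}" "app g x = app g y"
      then show "x = y"
        using nat_linear[OF nat_mem nat_mem, OF n _ n, of x y] mono[of x y] mono[of y x] by auto
    qed
    show "app g i \<epsilon> d \<and> \<not> app g i \<epsilon> n" if "i \<epsilon> n" for i
      using mono[of i n] large[of i] that mem_asym unfolding d by auto
    show "is_nat d" using large[of n] d by simp
  qed
qed

text \<open>The set \<open>r\<close> is the interval from \<open>n\<close> up to but excluding
  \<open>m\<close>. The cycle is the successor map, with the last element sent back to
  \<open>n\<close>; two distinct elements rule out fixed points.\<close>

lemma interval_cycle:
  assumes n: "is_nat n" and m: "is_nat m" and r: "\<And>z. z \<epsilon> r \<longleftrightarrow> z \<epsilon> m \<and> \<not> z \<epsilon> n"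
    and xy: "x \<epsilon> r" "y \<epsilon> r" "x \<noteq> y"
  obtains s where "tm (\<lambda>v. s (v 0))" "bij_betw s {x. x \<epsilon> r} {x. x \<epsilon> r}"
    "\<And>j. j \<epsilon> r \<Longrightarrow> s j \<noteq> j"
proof -
  have above: "z = n \<or> n \<epsilon> z" if "z \<epsilon> r" for z
    using that nat_linear[OF nat_mem[OF m, of z] n] by (auto simp: r)
  have nm: "n \<epsilon> m"
    using above[OF xy(1)] xy(1) nat_trans[OF m, of x n] by (auto simp: r)
  have sucr: "suc j \<epsilon> r" if "j \<epsilon> r" "suc j \<epsilon> m" for j
    using that nat_trans[OF n, of "suc j" j] by (auto simp: r)
  have last: "suc j = m" if "j \<epsilon> r" "\<not> suc j \<epsilon> m" for j
    using that suc_mem_nat[OF m, of j] by (auto simp: r)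
  have ne: "suc j \<noteq> n" if "j \<epsilon> r" for j
    using that by (auto simp: r)
  have nr: "n \<epsilon> r" using nm by (simp add: r)
  define s where "s j = (if suc j \<epsilon> m then suc j else n)" for j
  show thesis
  proof (rule that[of s])
    show "tm (\<lambda>v. s (v 0))" unfolding s_def by (intro dfn_set)
    show "bij_betw s {x. x \<epsilon> r} {x. x \<epsilon> r}"
      unfolding bij_betw_def
    proof (intro conjI inj_onI equalityI subsetI)
      fix j j' assume "j \<in> {x. x \<epsilon> r}" "j' \<in> {x. x \<epsilon> r}" "s j = s j'"
      then show "j = j'"
        using last[of j] last[of j'] ne[of j] ne[of j'] suc_inject[of j j']
        unfolding s_def by (auto split: if_splits)
    next
      fix z assume "z \<in> s ` {x. x \<epsilon> r}"
      then show "z \<in> {x. x \<epsilon> r}" using sucr nr by (auto simp: s_def)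
    next
      fix z assume "z \<in> {x. x \<epsilon> r}"
      then have z: "z \<epsilon> r" by simp
      \<comment> \<open>The case \<open>w = m\<close> is included because the predecessor of
        \<open>m\<close> is the preimage of \<open>n\<close>; all other elements of \<open>r\<close>
        are reached from their own predecessors.\<close>
      have pred: "\<exists>k. w = suc k \<and> k \<epsilon> r" if "is_nat w" "n \<epsilon> w" "w \<epsilon> m \<or> w = m" for w
        using \<open>is_nat w\<close>
      proof (cases rule: nat_cases)
        case 1
        then show ?thesis using that by simp
      next
        case (2 k)
        then have "k \<epsilon> m" using that nat_trans[OF m, of w k] by auto
        moreover have "\<not> k \<epsilon> n" using that 2 mem_asym by auto
        ultimately show ?thesis using 2 by (auto simp: r)
      qed
      show "z \<in> s ` {x. x \<epsilon> r}"
      proof (cases "z = n")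
        case True
        obtain k where "m = suc k" "k \<epsilon> r" using pred[OF m nm] by blast
        then have "s k = z" "k \<in> {x. x \<epsilon> r}" using True by (auto simp: s_def)
        then show ?thesis by blast
      next
        case False
        then obtain k where "z = suc k" "k \<epsilon> r"
          using pred[of z] above[OF z] nat_mem[OF m, of z] z by (auto simp: r)
        then have "s k = z" "k \<in> {x. x \<epsilon> r}" using z by (auto simp: s_def r)
        then show ?thesis by blast
      qed
    qed
    show "s j \<noteq> j" if j: "j \<epsilon> r" for j
    proof
      assume "s j = j"
      \<comment> \<open>A successor step moves its argument, so a fixed point can only arise from
        wrapping around, which makes \<open>n\<close> the sole element of \<open>r\<close>.\<close>
      then have "\<not> suc j \<epsilon> m" "j = n"
        by (auto simp: s_def split: if_splits) (metis mem_suc not_mem_self)+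
      then have "m = suc n" using last[OF j] by simp
      then have "z = n" if "z \<epsilon> r" for z using that above[OF that] mem_asym by (auto simp: r)
      then show False using xy by metis
    qed
  qed
qed

section \<open>Coding permutations\<close>

definition moved :: "'a \<Rightarrow> 'a \<Rightarrow> 'a \<Rightarrow> bool" where
  "moved A \<phi> x \<longleftrightarrow> x \<epsilon> A \<and> app \<phi> x \<noteq> x"

lemma is_moved_set_iff:
  "is_function \<phi> A A \<Longrightarrow> is_moved_set \<phi> A D \<longleftrightarrow> (\<forall>x. x \<epsilon> D \<longleftrightarrow> moved A \<phi> x)"
  by (auto simp: is_moved_set_def moved_def maps_app)

text \<open>Permutations of \<open>A\<close> are subsets of the product of \<open>A\<close> with
  itself, so separation from its power set suffices.\<close>

lemma S_exists: "\<exists>X. is_S k A X"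
proof -
  obtain Q where Q: "\<forall>p. p \<epsilon> Q \<longleftrightarrow> (\<exists>a b. a \<epsilon> A \<and> b \<epsilon> A \<and> p = pair a b)"
    using product_exists by blast
  obtain W where W: "\<forall>z. z \<epsilon> W \<longleftrightarrow> (\<forall>w. w \<epsilon> z \<longrightarrow> w \<epsilon> Q)" using power_exists by blast
  have "dfn (\<lambda>v. is_bijection (v 0) A A \<and> (\<exists>D. is_moved_set (v 0) A D \<and> equinumerous D k))"
    by (intro dfn_set)
  from separation[OF this, of W] obtain X where X: "\<forall>z. z \<epsilon> X \<longleftrightarrow>
      z \<epsilon> W \<and> is_bijection z A A \<and> (\<exists>D. is_moved_set z A D \<and> equinumerous D k)" by blast
  have "z \<epsilon> W" if "is_bijection z A A" for z
    using that unfolding W[rule_format] Q[rule_format] is_bijection_iff is_function_iff by blast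
  then show ?thesis using X unfolding is_S_def by blast
qed

end

text \<open>The index set \<open>suc n\<close> has one element more than the moved set of a permutation in
  \<open>S\<^sub>n(A)\<close>, so some row \<open>h i\<close> of the grid consists of fixed points. The shift \<open>g\<close>, which
  exists because of \<open>m \<ge> 2n\<close>, guarantees that a row has at least \<open>n\<close> elements.\<close>

locale coding = zf mem for mem :: "'a \<Rightarrow> 'a \<Rightarrow> bool" (infix "\<epsilon>" 50) +
  fixes A n m r :: 'a and h :: "'a \<Rightarrow> 'a \<Rightarrow> 'a" and s g :: "'a \<Rightarrow> 'a"
  assumes n: "is_nat n" and one_n: "suc emp \<epsilon> n"
    and r: "\<And>z. z \<epsilon> r \<longleftrightarrow> z \<epsilon> m \<and> \<not> z \<epsilon> n" and n_m: "\<And>z. z \<epsilon> n \<Longrightarrow> z \<epsilon> m"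
    and h_tm: "tm (\<lambda>v. h (v 0) (v (Suc 0)))"
    and h_in: "\<And>i j. i \<epsilon> suc n \<Longrightarrow> j \<epsilon> r \<Longrightarrow> h i j \<epsilon> A"
    and h_inj: "\<And>i j i' j'. i \<epsilon> suc n \<Longrightarrow> i' \<epsilon> suc n \<Longrightarrow> j \<epsilon> r \<Longrightarrow> j' \<epsilon> r \<Longrightarrow>
      h i j = h i' j' \<Longrightarrow> i = i' \<and> j = j'"
    and s_tm: "tm (\<lambda>v. s (v 0))"
    and s_bij: "bij_betw s {j. j \<epsilon> r} {j. j \<epsilon> r}"
    and s_moves: "\<And>j. j \<epsilon> r \<Longrightarrow> s j \<noteq> j"
    and g_tm: "tm (\<lambda>v. g (v 0))"
    and g_inj: "inj_on g {j. j \<epsilon> n}"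
    and g_in: "\<And>j. j \<epsilon> n \<Longrightarrow> g j \<epsilon> r"
begin

definition block :: "'a \<Rightarrow> 'a \<Rightarrow> bool" where
  "block i x \<longleftrightarrow> (\<exists>j. j \<epsilon> r \<and> x = h i j)"

text \<open>A definable inverse of \<open>h i\<close> on row \<open>i\<close>.\<close>

definition column :: "'a \<Rightarrow> 'a \<Rightarrow> 'a" where
  "column i x = the1 (\<lambda>j. j \<epsilon> r \<and> x = h i j)"

definition free :: "'a \<Rightarrow> 'a \<Rightarrow> bool" where
  "free \<phi> i \<longleftrightarrow> (\<forall>x. block i x \<longrightarrow> \<not> moved A \<phi> x)"

text \<open>Always choosing the least free row would not be injective: for \<open>m = 2n\<close>, the cycle on row
  0 extended by row 1 and the cycle on row 1 extended by row 0 coincide.\<close>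

definition sel :: "'a \<Rightarrow> 'a" where
  "sel \<phi> = (if \<forall>x. moved A \<phi> x \<longleftrightarrow> block (suc emp) x then suc (suc emp)
     else the1 (\<lambda>i. i \<epsilon> suc n \<and> free \<phi> i \<and> (\<forall>z. z \<epsilon> i \<longrightarrow> \<not> free \<phi> z)))"

definition act :: "'a \<Rightarrow> 'a \<Rightarrow> 'a" where
  "act \<phi> x = (if block (sel \<phi>) x then h (sel \<phi>) (s (column (sel \<phi>) x)) else app \<phi> x)"

definition code :: "'a \<Rightarrow> 'a" where
  "code \<phi> = lam A (act \<phi>)"

section \<open>Definability of the coding, and elementary facts on rows\<close>

lemma dfn_moved: "tm a \<Longrightarrow> tm b \<Longrightarrow> tm c \<Longrightarrow> dfn (\<lambda>v. moved (a v) (b v) (c v))"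
  by (rule dfn_subst3[rotated], assumption+, unfold moved_def) (intro dfn_set)

lemma dfn_block: "tm a \<Longrightarrow> tm b \<Longrightarrow> dfn (\<lambda>v. block (a v) (b v))"
  by (rule dfn_subst2[rotated], assumption+, unfold block_def) (intro dfn_set tm_apply2[OF h_tm])

lemma tm_column: "tm (\<lambda>v. column (v 0) (v (Suc 0)))"
  unfolding column_def by (intro dfn_set tm_apply2[OF h_tm])

lemma dfn_free: "tm a \<Longrightarrow> tm b \<Longrightarrow> dfn (\<lambda>v. free (a v) (b v))"
  by (rule dfn_subst2[rotated], assumption+, unfold free_def) (intro dfn_set dfn_block dfn_moved)

lemma tm_sel: "tm (\<lambda>v. sel (v 0))"
  unfolding sel_def by (intro dfn_set dfn_block dfn_moved dfn_free)

lemma tm_act: "tm (\<lambda>v. act (v 0) (v (Suc 0)))"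
  unfolding act_def
  by (intro dfn_set dfn_block tm_apply2[OF h_tm] tm_apply2[OF tm_column] tm_apply[OF s_tm]
        tm_apply[OF tm_sel])

lemma tm_act1: "tm (\<lambda>v. act \<phi> (v 0))"
  by (intro tm_apply2[OF tm_act] dfn_set)

lemma tm_code: "tm (\<lambda>v. code (v 0))"
  unfolding code_def by (intro dfn_set tm_apply2[OF tm_act])

lemma column_h: "i \<epsilon> suc n \<Longrightarrow> j \<epsilon> r \<Longrightarrow> column i (h i j) = j"
  unfolding column_def by (rule the1_eq) (simp, metis h_inj)

lemma emp_n: "emp \<epsilon> n"
  using emp_mem_nat[OF n] one_n by auto

text \<open>Because \<open>n\<close> exceeds 1, rows 0, 1 and 2 exist; these are the rows that
  \<open>sel\<close> takes in \<open>sel_block\<close>.\<close>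

lemma emp_suc_n: "emp \<epsilon> suc n" and one_suc_n: "suc emp \<epsilon> suc n"
  and two_suc_n: "suc (suc emp) \<epsilon> suc n"
  using suc_mem_nat[OF n one_n] emp_n one_n by auto

lemma suc_neq_emp: "suc x \<noteq> emp"
  by (metis mem_suc not_mem_emp)

lemma suc_neq: "suc x \<noteq> x"
  by (metis mem_suc not_mem_self)

lemma block_disjoint: "block i x \<Longrightarrow> block i' x \<Longrightarrow> i \<epsilon> suc n \<Longrightarrow> i' \<epsilon> suc n \<Longrightarrow> i = i'"
  unfolding block_def by (metis h_inj)

lemma block_nonempty: "\<exists>x. block i x"
  using g_in[OF emp_n] by (auto simp: block_def)

lemma block_sub: "i \<epsilon> suc n \<Longrightarrow> block i x \<Longrightarrow> x \<epsilon> A"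
  using h_in by (auto simp: block_def)

lemma row_bij: "i \<epsilon> suc n \<Longrightarrow> bij_betw (h i) {j. j \<epsilon> r} {x. block i x}"
  unfolding bij_betw_def inj_on_def using h_inj[of i i] by (fastforce simp: block_def)

lemma column_bij: "i \<epsilon> suc n \<Longrightarrow> bij_betw (column i) {x. block i x} {j. j \<epsilon> r}"
  by (rule bij_betw_byWitness[where f' = "h i"]) (auto simp: block_def column_h)

section \<open>The code of a single permutation\<close>

context
  fixes \<phi> D
  assumes \<phi>: "is_bijection \<phi> A A" and D: "\<And>x. x \<epsilon> D \<longleftrightarrow> moved A \<phi> x"
    and Dn: "equinumerous D n"
begin

text \<open>Through \<open>g\<close> a row has at least \<open>n\<close> points, while exactly
  \<open>n\<close> points are moved. If the row lies inside the moved set, the injection of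
  \<open>n\<close> via \<open>g\<close> and \<open>h i\<close> is onto it, so nothing else is
  moved.\<close>

lemma moved_eq_block:
  assumes "i \<epsilon> suc n" "\<And>x. block i x \<Longrightarrow> moved A \<phi> x"
  shows "moved A \<phi> x \<longleftrightarrow> block i x"
proof
  assume "moved A \<phi> x"
  then have "x \<epsilon> D" by (simp add: D)
  have "\<exists>j. j \<epsilon> n \<and> h i (g j) = x"
  proof (rule equinumerous_nat_injection_surj[OF n Dn _ _ _ \<open>x \<epsilon> D\<close>])
    show "tm (\<lambda>v. h i (g (v 0)))" by (intro dfn_set tm_apply2[OF h_tm] tm_apply[OF g_tm])
    show "inj_on (\<lambda>j. h i (g j)) {x. x \<epsilon> n}"
      using h_inj[OF assms(1) assms(1) g_in g_in] g_inj unfolding inj_on_def by blast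
    show "h i (g j) \<epsilon> D" if "j \<epsilon> n" for j
      using assms(2) g_in[OF that] by (auto simp: D block_def)
  qed
  then show "block i x" using g_in by (auto simp: block_def)
qed (rule assms(2))

lemma least_free:
  assumes "\<not> (\<forall>x. moved A \<phi> x \<longleftrightarrow> block (suc emp) x)"
  shows "sel \<phi> \<epsilon> suc n \<and> free \<phi> (sel \<phi>) \<and> (\<forall>z. z \<epsilon> sel \<phi> \<longrightarrow> \<not> free \<phi> z)"
proof -
  have "\<exists>i. i \<epsilon> suc n \<and> (\<forall>j. j \<epsilon> r \<longrightarrow> \<not> h i j \<epsilon> D)"
    by (rule free_row_exists[OF n Dn h_tm]) (use h_inj[THEN conjunct1] in assumption)
  then obtain i where i: "i \<epsilon> suc n" "free \<phi> i"
    by (auto simp: free_def block_def D)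
  have "dfn (\<lambda>v. free \<phi> (v 0))" by (intro dfn_set dfn_free)
  from the1I[OF least_unique[OF is_nat_suc[OF n] this i]] show ?thesis
    unfolding sel_def if_not_P[OF assms] .
qed

lemma sel_in: "sel \<phi> \<epsilon> suc n" and sel_free: "free \<phi> (sel \<phi>)"
proof -
  have "sel \<phi> \<epsilon> suc n \<and> free \<phi> (sel \<phi>)"
  proof (cases "\<forall>x. moved A \<phi> x \<longleftrightarrow> block (suc emp) x")
    \<comment> \<open>If exactly row 1 is moved, row 2 is free because rows are disjoint.\<close>
    case True
    then show ?thesis
      using two_suc_n block_disjoint[OF _ _ one_suc_n two_suc_n] suc_neq[of "suc emp"]
      by (auto simp: sel_def free_def)
  qed (use least_free in blast)
  then show "sel \<phi> \<epsilon> suc n" "free \<phi> (sel \<phi>)" by auto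
qed

text \<open>All rows except \<open>k\<close> are free, so the least free row is 1 for
  \<open>k = 0\<close> and 0 for \<open>k\<close> beyond 1, while \<open>k = 1\<close> was
  redirected to 2. The resulting map on rows has no fixed points and no two-cycles, which
  \<open>code_inj\<close> exploits.\<close>

lemma sel_block:
  assumes k: "k \<epsilon> suc n" and eq: "\<And>x. moved A \<phi> x \<longleftrightarrow> block k x"
  shows "sel \<phi> = (if k = suc emp then suc (suc emp) else if k = emp then suc emp else emp)"
proof (cases "k = suc emp")
  case True
  then show ?thesis using eq by (simp add: sel_def)
next
  case False
  have free: "free \<phi> i \<longleftrightarrow> i \<noteq> k" if "i \<epsilon> suc n" for i
    using block_disjoint[OF _ _ that k] block_nonempty[of i] by (auto simp: free_def eq)
  have "\<not> (\<forall>x. moved A \<phi> x \<longleftrightarrow> block (suc emp) x)"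
    using False free[OF one_suc_n] block_nonempty[of "suc emp"] by (auto simp: free_def)
  then have sel: "sel \<phi> \<epsilon> suc n" "sel \<phi> \<noteq> k" "\<And>z. z \<epsilon> sel \<phi> \<Longrightarrow> \<not> free \<phi> z"
    using least_free free by blast+
  have sel_nat: "is_nat (sel \<phi>)" using nat_mem[OF is_nat_suc[OF n] sel(1)] .
  show ?thesis
  proof (cases "k = emp")
    case True
    have "\<not> suc emp \<epsilon> sel \<phi>"
      using free[OF one_suc_n] sel(3) True suc_neq_emp by auto
    then have "sel \<phi> = suc emp"
      using nat_linear[OF sel_nat is_nat_suc[OF is_nat_emp]] sel(2) True by auto
    then show ?thesis using True suc_neq_emp[of emp] by auto
  next
    case False
    then have "\<not> emp \<epsilon> sel \<phi>" using free[OF emp_suc_n] sel(3) by auto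
    then show ?thesis
      using emp_mem_nat[OF sel_nat] False \<open>k \<noteq> suc emp\<close> by simp
  qed
qed

text \<open>As \<phi> fixes the selected row pointwise, it permutes the complement. There it is
  glued to the cycle \<open>s\<close>, carried over to the row by its column coordinate.\<close>

lemma act_bij: "bij_betw (act \<phi>) {x. x \<epsilon> A} {x. x \<epsilon> A}"
proof -
  let ?i = "sel \<phi>" and ?B = "{x. block (sel \<phi>) x}"
  have BA: "?B \<subseteq> {x. x \<epsilon> A}" using block_sub[OF sel_in] by blast
  have fixed: "app \<phi> x = x" if "x \<in> ?B" for x
    using that sel_free BA by (auto simp: free_def moved_def)
  have 1: "bij_betw (\<lambda>x. h ?i (s (column ?i x))) ?B ?B"
    using bij_betw_trans[OF bij_betw_trans[OF column_bij[OF sel_in] s_bij] row_bij[OF sel_in]]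
    by (simp add: comp_def)
  have \<phi>A: "bij_betw (app \<phi>) {x. x \<epsilon> A} {x. x \<epsilon> A}"
    using \<phi> by (simp add: is_bijection_iff)
  have "app \<phi> ` ({x. x \<epsilon> A} - ?B) = {x. x \<epsilon> A} - ?B"
  proof -
    have "app \<phi> ` ({x. x \<epsilon> A} - ?B) = app \<phi> ` {x. x \<epsilon> A} - app \<phi> ` ?B"
      using \<phi>A BA by (intro inj_on_image_set_diff[of _ "{x. x \<epsilon> A}"]) (auto simp: bij_betw_def)
    also have "app \<phi> ` ?B = ?B" using fixed by auto
    finally show ?thesis using \<phi>A by (simp add: bij_betw_def)
  qed
  then have 2: "bij_betw (app \<phi>) ({x. x \<epsilon> A} - ?B) ({x. x \<epsilon> A} - ?B)"
    using \<phi>A unfolding bij_betw_def by (blast intro: inj_on_subset)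
  have "bij_betw (\<lambda>x. if x \<in> ?B then h ?i (s (column ?i x)) else app \<phi> x)
      (?B \<union> ({x. x \<epsilon> A} - ?B)) (?B \<union> ({x. x \<epsilon> A} - ?B))"
    by (rule bij_betw_disjoint_Un[OF 1 2]) auto
  moreover have "?B \<union> ({x. x \<epsilon> A} - ?B) = {x. x \<epsilon> A}" using BA by blast
  moreover have "act \<phi> = (\<lambda>x. if x \<in> ?B then h ?i (s (column ?i x)) else app \<phi> x)"
    by (auto simp: act_def)
  ultimately show ?thesis by simp
qed

lemma code_bijection: "is_bijection (code \<phi>) A A"
proof -
  have "is_function (code \<phi>) A A"
    using act_bij unfolding code_def by (intro lam_function[OF tm_act1]) (auto simp: bij_betw_def)
  moreover have "bij_betw (app (code \<phi>)) {x. x \<epsilon> A} {x. x \<epsilon> A}"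
    using act_bij by (rule bij_betw_cong[THEN iffD1, rotated]) (simp add: code_def app_lam[OF tm_act1])
  ultimately show ?thesis by (simp add: is_bijection_iff)
qed

lemma app_code: "x \<epsilon> A \<Longrightarrow> app (code \<phi>) x = act \<phi> x"
  unfolding code_def by (rule app_lam[OF tm_act1])

lemma moved_code: "moved A (code \<phi>) x \<longleftrightarrow> moved A \<phi> x \<or> block (sel \<phi>) x"
proof (cases "block (sel \<phi>) x")
  case True
  then obtain j where j: "j \<epsilon> r" "x = h (sel \<phi>) j" by (auto simp: block_def)
  have "s j \<epsilon> r" using j(1) s_bij by (auto simp: bij_betw_def)
  then have "act \<phi> x \<noteq> x"
    using h_inj[OF sel_in sel_in _ j(1)] s_moves[OF j(1)] True
    by (auto simp: act_def j column_h[OF sel_in])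
  then show ?thesis using True block_sub[OF sel_in True] by (simp add: moved_def app_code)
next
  case False
  then show ?thesis by (auto simp: moved_def app_code act_def)
qed

text \<open>The moved set of the code splits into \<open>D\<close>, which is counted by
  \<open>n\<close>, and the selected row, which \<open>column\<close> maps onto \<open>r\<close>;
  together \<open>n\<close> and \<open>r\<close> make up \<open>m\<close>.\<close>

lemma moved_code_equinumerous:
  assumes E: "\<And>x. x \<epsilon> E \<longleftrightarrow> moved A (code \<phi>) x"
  shows "equinumerous E m"
proof -
  obtain F where F: "tm (\<lambda>v. F (v 0))" "bij_betw F {x. x \<epsilon> D} {x. x \<epsilon> n}"
    using Dn by (rule equinumerousE)
  let ?F = "\<lambda>x. if x \<epsilon> D then F x else column (sel \<phi>) x"
  have "bij_betw (\<lambda>x. if x \<in> {x. x \<epsilon> D} then F x else column (sel \<phi>) x)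
      ({x. x \<epsilon> D} \<union> {x. block (sel \<phi>) x}) ({x. x \<epsilon> n} \<union> {x. x \<epsilon> r})"
    using sel_free by (intro bij_betw_disjoint_Un F(2) column_bij sel_in) (auto simp: free_def D r)
  moreover have "{x. x \<epsilon> D} \<union> {x. block (sel \<phi>) x} = {x. x \<epsilon> E}"
    by (auto simp: E D moved_code)
  moreover have "{x. x \<epsilon> n} \<union> {x. x \<epsilon> r} = {x. x \<epsilon> m}"
    using n_m by (auto simp: r)
  ultimately have "bij_betw ?F {x. x \<epsilon> E} {x. x \<epsilon> m}" by simp
  moreover have "tm (\<lambda>v. ?F (v 0))"
    by (intro dfn_set tm_apply[OF F(1)] tm_apply2[OF tm_column])
  ultimately show ?thesis by (intro equinumerousI)
qed

end

section \<open>Injectivity of the coding\<close>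

lemma S_moved:
  assumes "is_S k A X" "\<phi> \<epsilon> X"
  obtains D where "is_bijection \<phi> A A" "\<And>x. x \<epsilon> D \<longleftrightarrow> moved A \<phi> x" "equinumerous D k"
proof -
  obtain D where D: "is_bijection \<phi> A A" "is_moved_set \<phi> A D" "equinumerous D k"
    using assms unfolding is_S_def by blast
  then have "\<And>x. x \<epsilon> D \<longleftrightarrow> moved A \<phi> x"
    by (simp add: is_moved_set_iff is_bijection_iff)
  with D that show thesis by blast
qed

lemma code_in:
  assumes X: "is_S n A X" and Y: "is_S m A Y" and \<phi>: "\<phi> \<epsilon> X"
  shows "code \<phi> \<epsilon> Y"
proof -
  obtain D where D: "is_bijection \<phi> A A" "\<And>x. x \<epsilon> D \<longleftrightarrow> moved A \<phi> x" "equinumerous D n"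
    using S_moved[OF X \<phi>] by blast
  have "dfn (\<lambda>v. moved A (code \<phi>) (v 0))" by (intro dfn_set dfn_moved)
  from separation[OF this, of A] obtain E where "\<forall>x. x \<epsilon> E \<longleftrightarrow> x \<epsilon> A \<and> moved A (code \<phi>) x" by blast
  then have E: "x \<epsilon> E \<longleftrightarrow> moved A (code \<phi>) x" for x by (auto simp: moved_def)
  have "is_moved_set (code \<phi>) A E"
    using code_bijection[OF D] E by (simp add: is_moved_set_iff is_bijection_iff)
  then show ?thesis
    using Y code_bijection[OF D] moved_code_equinumerous[OF D E] unfolding is_S_def by blast
qed

lemma code_inj:
  assumes X: "is_S n A X" and \<phi>: "\<phi> \<epsilon> X" and \<psi>: "\<psi> \<epsilon> X" and eq: "code \<phi> = code \<psi>"
  shows "\<phi> = \<psi>"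
proof -
  obtain D where D: "is_bijection \<phi> A A" "\<And>x. x \<epsilon> D \<longleftrightarrow> moved A \<phi> x" "equinumerous D n"
    using S_moved[OF X \<phi>] by blast
  obtain E where E: "is_bijection \<psi> A A" "\<And>x. x \<epsilon> E \<longleftrightarrow> moved A \<psi> x" "equinumerous E n"
    using S_moved[OF X \<psi>] by blast
  have union: "moved A \<phi> x \<or> block (sel \<phi>) x \<longleftrightarrow> moved A \<psi> x \<or> block (sel \<psi>) x" for x
    using moved_code[OF D, of x] moved_code[OF E, of x] eq by simp
  have "sel \<phi> = sel \<psi>"
  proof (rule ccontr)
    assume neq: "sel \<phi> \<noteq> sel \<psi>"
    \<comment> \<open>The moved sets of both codes coincide. Distinct rows being disjoint, the row
      added to one permutation must be moved by the other.\<close>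
    have "block (sel \<psi>) x \<Longrightarrow> moved A \<phi> x" "block (sel \<phi>) x \<Longrightarrow> moved A \<psi> x" for x
      using union[of x] neq block_disjoint[OF _ _ sel_in[OF D] sel_in[OF E]] by blast+
    then have "moved A \<phi> x \<longleftrightarrow> block (sel \<psi>) x" "moved A \<psi> x \<longleftrightarrow> block (sel \<phi>) x" for x
      using moved_eq_block[OF D sel_in[OF E]] moved_eq_block[OF E sel_in[OF D]] by blast+
    \<comment> \<open>Each permutation moves exactly the row selected for the other, so the two rows
      would form a two-cycle of the map in \<open>sel_block\<close>.\<close>
    from sel_block[OF D sel_in[OF E] this(1)] sel_block[OF E sel_in[OF D] this(2)]
    show False using neq suc_neq_emp suc_neq by metis
  qed
  show ?thesis
  proof (rule function_ext)
    show "is_function \<phi> A A" "is_function \<psi> A A" using D(1) E(1) by (auto simp: is_bijection_iff)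
    show "app \<phi> x = app \<psi> x" if x: "x \<epsilon> A" for x
    proof (cases "block (sel \<phi>) x")
      case True
      \<comment> \<open>On the common row the codes carry no information, but both permutations are
        the identity there; elsewhere the codes agree with them.\<close>
      then have "\<not> moved A \<phi> x" "\<not> moved A \<psi> x"
        using sel_free[OF D] sel_free[OF E] \<open>sel \<phi> = sel \<psi>\<close> by (auto simp: free_def)
      then show ?thesis using x by (simp add: moved_def)
    next
      case False
      then show ?thesis
        using app_code[OF D x] app_code[OF E x] eq \<open>sel \<phi> = sel \<psi>\<close> by (simp add: act_def)
    qed
  qed
qed

lemma S_injection: "\<exists>X Y f. is_S n A X \<and> is_S m A Y \<and> is_injection f X Y"
proof -
  obtain X Y where X: "is_S n A X" and Y: "is_S m A Y" using S_exists by blast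
  have "is_injection (lam X code) X Y"
    using code_in[OF X Y] code_inj[OF X]
    by (auto simp: is_injection_iff inj_on_def app_lam[OF tm_code] intro!: lam_function[OF tm_code])
  with X Y show ?thesis by blast
qed

end

section \<open>Supplying the rows, the shift, the cycle and the grid for the coding\<close>

theorem theorem2p7:
  fixes mem :: "'a \<Rightarrow> 'a \<Rightarrow> bool" and n m A :: 'a
  assumes "set_structure.ZF_model mem"
    and "set_structure.is_nat mem n"
    and "set_structure.is_nat mem m"
    and "\<exists>i. set_structure.is_one mem i \<and> mem i n"
    and "\<exists>d. set_structure.is_sum mem n n d \<and> (mem d m \<or> d = m)"
    and "set_structure.is_infinite mem A"
  shows "\<exists>X Y f. set_structure.is_S mem n A X \<and> set_structure.is_S mem m A Y
           \<and> set_structure.is_injection mem f X Y"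
proof -
  interpret zf mem by unfold_locales (rule assms(1))
  note n = assms(2) and m = assms(3)
  have one: "mem (suc emp) n"
    using assms(4) by (auto simp: is_one_def is_empty_iff is_succ_iff)
  have zero: "mem emp n" using emp_mem_nat[OF n] one by auto
  obtain d where d: "is_sum n n d" "mem d m \<or> d = m" using assms(5) by blast
  obtain g where g: "tm (\<lambda>v. g (v 0))" "inj_on g {i. mem i n}"
    and g_d: "\<And>i. mem i n \<Longrightarrow> mem (g i) d \<and> \<not> mem (g i) n" and "is_nat d"
    using sum_shift[OF n d(1)] by blast
  have d_m: "mem z m" if "mem z d" for z using that d(2) nat_trans[OF m] by blast
  have "dfn (\<lambda>v. \<not> mem (v 0) n)" by (intro dfn_set)
  \<comment> \<open>The difference of \<open>m\<close> and \<open>n\<close> indexes the columns, so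
    that adding one row to \<open>n\<close> moved points gives \<open>m\<close> of them.\<close>
  from separation[OF this, of m] obtain r
    where r: "\<forall>z. mem z r \<longleftrightarrow> mem z m \<and> \<not> mem z n" by blast
  have g_r: "mem (g i) r" if "mem i n" for i using g_d[OF that] d_m r by blast
  have n_m: "mem z m" if "mem z n" for z
  proof -
    \<comment> \<open>The value of the shift at 0 is at least \<open>n\<close> and lies below
      \<open>m\<close>, which yields \<open>n\<close> below \<open>m\<close>.\<close>
    have "g emp = n \<or> mem n (g emp)"
      using nat_linear[OF nat_mem[OF \<open>is_nat d\<close>] n] g_d[OF zero] by blast
    then have "mem n m" using g_d[OF zero] d_m nat_trans[OF m] by blast
    then show ?thesis using that nat_trans[OF m] by blast
  qed
  \<comment> \<open>As 0 and 1 lie in \<open>n\<close>, the shift provides the two distinct elements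
    of \<open>r\<close> that a cycle without fixed points needs.\<close>
  have "g emp \<noteq> g (suc emp)"
    using g(2) zero one unfolding inj_on_def by (metis mem_Collect_eq mem_suc not_mem_emp)
  then obtain s where s: "tm (\<lambda>v. s (v 0))" "bij_betw s {x. mem x r} {x. mem x r}"
    "\<And>j. mem j r \<Longrightarrow> s j \<noteq> j"
    using interval_cycle[OF n m r[rule_format] g_r[OF zero] g_r[OF one]] by blast
  \<comment> \<open>The grid is taken with all \<open>m\<close> columns, since \<open>m\<close> is a
    natural number and \<open>r\<close> in general is not; only the columns in \<open>r\<close> are
    used.\<close>
  obtain h where h: "tm (\<lambda>v. h (v 0) (v (Suc 0)))"
    "\<And>i j. mem i (suc n) \<Longrightarrow> mem j m \<Longrightarrow> mem (h i j) A"
    "\<And>i j i' j'. mem i (suc n) \<Longrightarrow> mem i' (suc n) \<Longrightarrow> mem j m \<Longrightarrow> mem j' m \<Longrightarrow>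
       h i j = h i' j' \<Longrightarrow> i = i' \<and> j = j'"
    using grid_in_infinite[OF assms(6) is_nat_suc[OF n] m] by blast
  interpret coding mem A n m r h s g
  proof unfold_locales
    show "i = i' \<and> j = j'" if "mem i (suc n)" "mem i' (suc n)" "mem j r" "mem j' r"
      "h i j = h i' j'" for i j i' j'
      using h(3) that r by blast
    show "mem (h i j) A" if "mem i (suc n)" "mem j r" for i j
      using h(2) that r by blast
  qed (use n one r n_m h(1) s g g_r in auto)
  show ?thesis by (rule S_injection)
qed

end
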